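(* Let $X$ be a metric space with metric $d$. Suppose that for all $R>0$ and $\varepsilon>0$ there is a partition of unity $(\varphi_i)_{i\in I}$ on $X$ such that (i) for all $x,y\in X$ with $d(x,y)\leq R$ one has $\sum_{i\in I}|\varphi_i(x)-\varphi_i(y)|\leq \varepsilon$; and (ii) $(\varphi_i)_{i\in I}$ is subordinated to an equi-uniformly embeddable cover $(U_i)_{i\in I}$ of $X$ (each $U_i$ carrying the metric induced from $X$). Then $X$ is uniformly embeddable.
   Context: Partition of unity: for a set $X$, a partition of unity on $X$ is a family of maps $(\varphi_i)_{i\in I}$, $\varphi_i:X\to[0,1]$, with $\sum_{i\in I}\varphi_i(x)=1$ for all $x\in X$ (for given $x$, the set $\{i:\varphi_i(x)\neq 0\}$ is not required to be finite). It is subordinated to a cover $(U_i)_{i\in I}$ of $X$ if each $\varphi_i$ vanishes outside $U_i$. Uniformly embeddable: a metric space $(X,d)$ is uniformly embeddable if there exist a real Hilbert space $\mathcal{H}$, a map $F:X\to\mathcal{H}$ and non-decreasing functions $\rho_\pm:\mathbb{R}_+\to\mathbb{R}_+$ with $\lim_{t\to\infty}\rho_\pm(t)=\infty$ such that $\rho_-(d(x,x'))\leq\|F(x)-F(x')\|\leq\rho_+(d(x,x'))$ for all $x,x'\in X$. Equi-uniformly embeddable: a family of metric spaces $(X_i,d_i)_{i\in I}$ is equi-uniformly embeddable if there are Hilbert space valued maps $F_i:X_i\to H_i$ and non-decreasing functions $\rho_\pm:\mathbb{R}_+\to\mathbb{R}_+$ (independent of $i$) with $\lim_{t\to\infty}\rho_\pm(t)=\infty$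 such that $\rho_-(d_i(x,y))\leq\|F_i(x)-F_i(y)\|\leq\rho_+(d_i(x,y))$ for all $i$ and all $x,y\in X_i$. *)

theory Defs
  imports "HOL-Analysis.Analysis" "HOL-Algebra.Module"
begin

section \<open>Real Hilbert spaces\<close>

text \<open>
  Hilbert spaces are existentially quantified below, individually for each member of a family, so
  they have to be values rather than types of class \<open>{real_inner, complete_space}\<close>.
  The fields \<open>mult\<close> and \<open>one\<close> that \<open>module\<close> inherits from
  \<open>ring\<close> play no role.
\<close>

abbreviation real_ring :: "real ring" where
  "real_ring \<equiv> \<lparr>carrier = UNIV, monoid.mult = (*), one = 1, zero = 0, add = (+)\<rparr>"

record 'h inner_space = "(real, 'h) module" +
  ip :: "'h \<Rightarrow> 'h \<Rightarrow> real"

definition hnorm :: "('h, 'b) inner_space_scheme \<Rightarrow> 'h \<Rightarrow> real" where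
  "hnorm H x = sqrt (ip H x x)"

text \<open>
  The locale \<open>Metric_space\<close> demands nonnegativity and symmetry outside the carrier as well,
  hence the value 0 there.
\<close>

definition hdist :: "('h, 'b) inner_space_scheme \<Rightarrow> 'h \<Rightarrow> 'h \<Rightarrow> real" where
  "hdist H x y =
     (if x \<in> carrier H \<and> y \<in> carrier H then hnorm H (x \<ominus>\<^bsub>H\<^esub> y) else 0)"

locale real_inner_space = Module.module real_ring H
  for H :: "('h, 'b) inner_space_scheme" (structure) +
  assumes ip_commute:
      "\<lbrakk>x \<in> carrier H; y \<in> carrier H\<rbrakk> \<Longrightarrow> ip H x y = ip H y x"
    and ip_add_left:
      "\<lbrakk>x \<in> carrier H; y \<in> carrier H; z \<in> carrier H\<rbrakk>
        \<Longrightarrow> ip H (x \<oplus>\<^bsub>H\<^esub> y) z = ip H x z + ip H y z"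
    and ip_smult_left:
      "\<lbrakk>x \<in> carrier H; y \<in> carrier H\<rbrakk> \<Longrightarrow> ip H (a \<odot>\<^bsub>H\<^esub> x) y = a * ip H x y"
    and ip_ge_zero: "x \<in> carrier H \<Longrightarrow> 0 \<le> ip H x x"
    and ip_eq_zero: "\<lbrakk>x \<in> carrier H; ip H x x = 0\<rbrakk> \<Longrightarrow> x = \<zero>\<^bsub>H\<^esub>"

locale real_hilbert_space = real_inner_space +
  assumes complete: "Metric_space.mcomplete (carrier H) (hdist H)"


section \<open>Uniform embeddability\<close>

definition control_function :: "(real \<Rightarrow> real) \<Rightarrow> bool" where
  "control_function \<rho> \<longleftrightarrow>
     (\<forall>t\<ge>0. 0 \<le> \<rho> t) \<and> mono_on {0..} \<rho> \<and> filterlim \<rho> at_top at_top"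

definition controlled_embedding ::
    "(real \<Rightarrow> real) \<Rightarrow> (real \<Rightarrow> real) \<Rightarrow> 'a set \<Rightarrow> ('a \<Rightarrow> 'a \<Rightarrow> real) \<Rightarrow>
     'h inner_space \<Rightarrow> ('a \<Rightarrow> 'h) \<Rightarrow> bool" where
  "controlled_embedding \<rho>\<^sub>l \<rho>\<^sub>u X d H F \<longleftrightarrow>
     real_hilbert_space H \<and> F \<in> X \<rightarrow> carrier H \<and>
     (\<forall>x\<in>X. \<forall>y\<in>X. \<rho>\<^sub>l (d x y) \<le> hdist H (F x) (F y) \<and>
                    hdist H (F x) (F y) \<le> \<rho>\<^sub>u (d x y))"

text \<open>
  HOL cannot quantify existentially over the type of the points of the Hilbert space. For a metric
  space with points in \<^typ>\<open>'a\<close> they are taken from the type \<^typ>\<open>'a \<Rightarrow> real\<close>, with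
  arbitrary carrier, operations and inner product. This is no restriction: a controlled embedding
  into a Hilbert space over any other type can be replaced by one of this kind, see
  \<open>uniformly_embeddableI\<close> and \<open>equi_uniformly_embeddableI\<close> below.
\<close>

definition uniformly_embeddable :: "'a set \<Rightarrow> ('a \<Rightarrow> 'a \<Rightarrow> real) \<Rightarrow> bool" where
  "uniformly_embeddable X d \<longleftrightarrow>
     (\<exists>(H :: ('a \<Rightarrow> real) inner_space) F \<rho>\<^sub>l \<rho>\<^sub>u.
        control_function \<rho>\<^sub>l \<and> control_function \<rho>\<^sub>u \<and>
        controlled_embedding \<rho>\<^sub>l \<rho>\<^sub>u X d H F)"

definition equi_uniformly_embeddable ::
    "'i set \<Rightarrow> ('i \<Rightarrow> 'a set) \<Rightarrow> ('i \<Rightarrow> 'a \<Rightarrow> 'a \<Rightarrow> real) \<Rightarrow> bool" where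
  "equi_uniformly_embeddable I X d \<longleftrightarrow>
     (\<exists>(H :: 'i \<Rightarrow> ('a \<Rightarrow> real) inner_space) F \<rho>\<^sub>l \<rho>\<^sub>u.
        control_function \<rho>\<^sub>l \<and> control_function \<rho>\<^sub>u \<and>
        (\<forall>i\<in>I. controlled_embedding \<rho>\<^sub>l \<rho>\<^sub>u (X i) (d i) (H i) (F i)))"


section \<open>Partitions of unity\<close>

text \<open>
  \<open>has_sum\<close> is unordered summation over an arbitrary index set; neither finiteness of \<open>I\<close> nor
  of the supports is required. The functions \<open>i \<mapsto> \<phi> i x\<close> being summable and nonnegative,
  \<open>i \<mapsto> \<bar>\<phi> i x - \<phi> i y\<bar>\<close> is summable too, so its \<open>infsum\<close> is a genuine sum.
\<close>

definition partition_of_unity :: "'a set \<Rightarrow> 'i set \<Rightarrow> ('i \<Rightarrow> 'a \<Rightarrow> real) \<Rightarrow> bool" where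
  "partition_of_unity X I \<phi> \<longleftrightarrow>
     (\<forall>i\<in>I. \<phi> i \<in> X \<rightarrow> {0..1}) \<and> (\<forall>x\<in>X. ((\<lambda>i. \<phi> i x) has_sum 1) I)"

definition cover_of :: "'a set \<Rightarrow> 'i set \<Rightarrow> ('i \<Rightarrow> 'a set) \<Rightarrow> bool" where
  "cover_of X I U \<longleftrightarrow> (\<forall>i\<in>I. U i \<subseteq> X) \<and> X \<subseteq> (\<Union>i\<in>I. U i)"

definition subordinated_to ::
    "'a set \<Rightarrow> 'i set \<Rightarrow> ('i \<Rightarrow> 'a \<Rightarrow> real) \<Rightarrow> ('i \<Rightarrow> 'a set) \<Rightarrow> bool" where
  "subordinated_to X I \<phi> U \<longleftrightarrow> (\<forall>i\<in>I. \<forall>x\<in>X - U i. \<phi> i x = 0)"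


section \<open>Independence of the type of the Hilbert space\<close>

lemma cring_real_ring: "cring real_ring"
proof (rule cringI)
  show "abelian_group real_ring"
  proof (rule abelian_groupI)
    fix x :: real
    assume "x \<in> carrier real_ring"
    show "\<exists>y\<in>carrier real_ring. y \<oplus>\<^bsub>real_ring\<^esub> x = \<zero>\<^bsub>real_ring\<^esub>"
      by (auto intro: exI[of _ "- x"])
  qed auto
  show "Group.comm_monoid real_ring"
    by (rule comm_monoidI) auto
qed (auto simp: algebra_simps)

context real_inner_space
begin

lemma ip_add_right:
  "\<lbrakk>x \<in> carrier H; y \<in> carrier H; z \<in> carrier H\<rbrakk>
    \<Longrightarrow> ip H z (x \<oplus>\<^bsub>H\<^esub> y) = ip H z x + ip H z y"
  by (simp add: ip_commute[of z] ip_add_left)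

lemma smult_in [simp, intro]: "x \<in> carrier H \<Longrightarrow> a \<odot>\<^bsub>H\<^esub> x \<in> carrier H"
  by (rule smult_closed) auto

lemma ip_smult_right:
  "\<lbrakk>x \<in> carrier H; y \<in> carrier H\<rbrakk> \<Longrightarrow> ip H y (a \<odot>\<^bsub>H\<^esub> x) = a * ip H y x"
  by (simp add: ip_commute[of y] ip_smult_left)

lemma ip_zero_left [simp]: "x \<in> carrier H \<Longrightarrow> ip H \<zero>\<^bsub>H\<^esub> x = 0"
  using ip_add_left[of "\<zero>\<^bsub>H\<^esub>" "\<zero>\<^bsub>H\<^esub>" x] by simp

lemma ip_neg_left: "\<lbrakk>x \<in> carrier H; y \<in> carrier H\<rbrakk> \<Longrightarrow> ip H (\<ominus>\<^bsub>H\<^esub> x) y = - ip H x y"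
  using ip_add_left[of "x" "\<ominus>\<^bsub>H\<^esub> x" y] by (simp add: M.r_neg)

lemma ip_diff_left:
  "\<lbrakk>x \<in> carrier H; y \<in> carrier H; z \<in> carrier H\<rbrakk>
    \<Longrightarrow> ip H (x \<ominus>\<^bsub>H\<^esub> y) z = ip H x z - ip H y z"
  by (simp add: a_minus_def ip_add_left ip_neg_left)

lemma ip_diff_right:
  "\<lbrakk>x \<in> carrier H; y \<in> carrier H; z \<in> carrier H\<rbrakk>
    \<Longrightarrow> ip H z (x \<ominus>\<^bsub>H\<^esub> y) = ip H z x - ip H z y"
  by (simp add: ip_commute[of z] ip_diff_left)

lemma minus_in: "\<lbrakk>x \<in> carrier H; y \<in> carrier H\<rbrakk> \<Longrightarrow> x \<ominus>\<^bsub>H\<^esub> y \<in> carrier H"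
  by simp

lemma eq_if_minus_zero:
  assumes "x \<in> carrier H" "y \<in> carrier H" "x \<ominus>\<^bsub>H\<^esub> y = \<zero>\<^bsub>H\<^esub>"
  shows "x = y"
proof -
  have "\<ominus>\<^bsub>H\<^esub> (\<ominus>\<^bsub>H\<^esub> y) = x"
    using assms by (intro M.minus_equality) (simp_all add: a_minus_def)
  with assms(2) show ?thesis by simp
qed

lemma hnorm_ge_zero: "x \<in> carrier H \<Longrightarrow> 0 \<le> hnorm H x"
  by (simp add: hnorm_def ip_ge_zero)

lemma hnorm_sq: "x \<in> carrier H \<Longrightarrow> (hnorm H x)\<^sup>2 = ip H x x"
  by (simp add: hnorm_def ip_ge_zero)

lemma Cauchy_Schwarz:
  assumes "x \<in> carrier H" "y \<in> carrier H"
  shows "\<bar>ip H x y\<bar> \<le> hnorm H x * hnorm H y"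
proof (cases "ip H y y = 0")
  case True
  then have "y = \<zero>\<^bsub>H\<^esub>" using assms ip_eq_zero by blast
  then have "ip H x y = 0" using assms ip_commute[of x y] by simp
  then show ?thesis using assms by (simp add: hnorm_ge_zero)
next
  case False
  then have pos: "ip H y y > 0" using ip_ge_zero[OF assms(2)] by simp
  define t where "t = ip H x y / ip H y y"
  have "0 \<le> ip H (x \<ominus>\<^bsub>H\<^esub> t \<odot>\<^bsub>H\<^esub> y) (x \<ominus>\<^bsub>H\<^esub> t \<odot>\<^bsub>H\<^esub> y)"
    using assms by (intro ip_ge_zero) simp
  also have "\<dots> = ip H x x - 2 * t * ip H x y + t\<^sup>2 * ip H y y"
    using assms by (simp add: ip_diff_left ip_diff_right ip_smult_left ip_smult_right
        ip_commute[of y x] power2_eq_square algebra_simps)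
  also have "\<dots> = ip H x x - (ip H x y)\<^sup>2 / ip H y y"
    using pos by (simp add: t_def field_simps power2_eq_square)
  finally have "(ip H x y)\<^sup>2 \<le> ip H x x * ip H y y"
    using pos by (simp add: field_simps)
  then have "sqrt ((ip H x y)\<^sup>2) \<le> sqrt (ip H x x * ip H y y)"
    by (rule real_sqrt_le_mono)
  then show ?thesis by (simp add: hnorm_def real_sqrt_mult)
qed

lemma hnorm_triangle:
  assumes "x \<in> carrier H" "y \<in> carrier H"
  shows "hnorm H (x \<oplus>\<^bsub>H\<^esub> y) \<le> hnorm H x + hnorm H y"
proof (rule power2_le_imp_le)
  have "(hnorm H (x \<oplus>\<^bsub>H\<^esub> y))\<^sup>2 = ip H x x + 2 * ip H x y + ip H y y"
    using assms by (simp add: hnorm_sq ip_add_left ip_add_right ip_commute[of y x])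
  also have "\<dots> \<le> (hnorm H x)\<^sup>2 + (hnorm H y)\<^sup>2 + 2 * hnorm H x * hnorm H y"
    using Cauchy_Schwarz[OF assms] assms by (simp add: hnorm_sq)
  finally show "(hnorm H (x \<oplus>\<^bsub>H\<^esub> y))\<^sup>2 \<le> (hnorm H x + hnorm H y)\<^sup>2"
    by (simp only: power2_sum)
  show "0 \<le> hnorm H x + hnorm H y"
    using hnorm_ge_zero[OF assms(1)] hnorm_ge_zero[OF assms(2)] by (rule add_nonneg_nonneg)
qed

lemma hdist_sq:
  assumes "x \<in> carrier H" "y \<in> carrier H"
  shows "hdist H x y = sqrt (ip H x x - 2 * ip H x y + ip H y y)"
proof -
  have "ip H (x \<ominus>\<^bsub>H\<^esub> y) (x \<ominus>\<^bsub>H\<^esub> y) = ip H x x - 2 * ip H x y + ip H y y"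
    using assms by (simp add: ip_diff_left ip_diff_right ip_commute[of y x])
  then show ?thesis
    using assms by (simp only: hdist_def hnorm_def simp_thms if_True)
qed

lemma hdist_commute: "hdist H x y = hdist H y x"
proof (cases "x \<in> carrier H \<and> y \<in> carrier H")
  case True
  then have "ip H y x = ip H x y"
    by (simp add: ip_commute)
  with True show ?thesis
    by (simp add: hdist_sq add.commute[of _ "ip H y y"] diff_add_eq add_diff_eq)
qed (auto simp: hdist_def)

lemma hdist_triangle:
  assumes "x \<in> carrier H" "y \<in> carrier H" "z \<in> carrier H"
  shows "hdist H x z \<le> hdist H x y + hdist H y z"
proof -
  have "(x \<ominus>\<^bsub>H\<^esub> y) \<oplus>\<^bsub>H\<^esub> (y \<ominus>\<^bsub>H\<^esub> z) = x \<oplus>\<^bsub>H\<^esub> (\<ominus>\<^bsub>H\<^esub> y \<oplus>\<^bsub>H\<^esub> y) \<oplus>\<^bsub>H\<^esub> \<ominus>\<^bsub>H\<^esub> z"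
    using assms unfolding a_minus_def by (simp add: M.a_assoc del: M.l_neg)
  also have "\<dots> = x \<ominus>\<^bsub>H\<^esub> z"
    using assms by (simp add: M.l_neg a_minus_def)
  finally have "hnorm H (x \<ominus>\<^bsub>H\<^esub> z) \<le> hnorm H (x \<ominus>\<^bsub>H\<^esub> y) + hnorm H (y \<ominus>\<^bsub>H\<^esub> z)"
    using hnorm_triangle[OF minus_in[OF assms(1,2)] minus_in[OF assms(2,3)]] by (simp only:)
  then show ?thesis
    using assms by (simp only: hdist_def simp_thms if_True)
qed

lemma hdist_eq_zero:
  assumes "x \<in> carrier H" "y \<in> carrier H"
  shows "hdist H x y = 0 \<longleftrightarrow> x = y"
proof
  assume "hdist H x y = 0"
  then have "ip H (x \<ominus>\<^bsub>H\<^esub> y) (x \<ominus>\<^bsub>H\<^esub> y) = 0"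
    using assms by (simp add: hdist_def hnorm_def)
  then have "x \<ominus>\<^bsub>H\<^esub> y = \<zero>\<^bsub>H\<^esub>"
    using assms by (intro ip_eq_zero) auto
  then show "x = y"
    by (rule eq_if_minus_zero[OF assms])
qed (use assms in \<open>simp add: hdist_sq\<close>)

lemma Metric_space_hdist: "Metric_space (carrier H) (hdist H)"
proof
  show "0 \<le> hdist H x y" for x y
    by (auto simp: hdist_def hnorm_ge_zero)
  show "hdist H x y = hdist H y x" for x y
    by (rule hdist_commute)
qed (rule hdist_eq_zero hdist_triangle; assumption)+

end

text \<open>The library's Hilbert space types are instances.\<close>

definition hilbert_of_type :: "'h :: {real_inner, complete_space} itself \<Rightarrow> 'h inner_space" where
  "hilbert_of_type _ =
     \<lparr>carrier = UNIV, monoid.mult = (\<lambda>x y. x), one = 0, zero = 0, add = (+),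
      smult = (*\<^sub>R), ip = inner\<rparr>"

lemma real_inner_space_of_type: "real_inner_space (hilbert_of_type TYPE('h))"
  for dummy :: "'h :: {real_inner, complete_space}"
proof (intro real_inner_space.intro real_inner_space_axioms.intro)
  have "abelian_group (hilbert_of_type TYPE('h))"
  proof (rule abelian_groupI)
    fix x :: 'h
    show "\<exists>y\<in>carrier (hilbert_of_type TYPE('h)).
        y \<oplus>\<^bsub>hilbert_of_type TYPE('h)\<^esub> x = \<zero>\<^bsub>hilbert_of_type TYPE('h)\<^esub>"
      by (auto simp: hilbert_of_type_def intro: exI[of _ "- x"])
  qed (auto simp: hilbert_of_type_def add.assoc add.commute)
  then show "Module.module real_ring (hilbert_of_type TYPE('h))"
    by (rule Module.moduleI[OF cring_real_ring])
      (auto simp: hilbert_of_type_def scaleR_add_left scaleR_add_right)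
qed (auto simp: hilbert_of_type_def inner_commute inner_add_right)

lemma hdist_of_type: "hdist (hilbert_of_type TYPE('h)) = dist"
  for dummy :: "'h :: {real_inner, complete_space}"
proof (intro ext)
  interpret real_inner_space "hilbert_of_type TYPE('h)"
    by (rule real_inner_space_of_type)
  fix x y :: 'h
  have "hdist (hilbert_of_type TYPE('h)) x y = sqrt (inner x x - 2 * inner x y + inner y y)"
    by (subst hdist_sq) (simp_all add: hilbert_of_type_def)
  also have "inner x x - 2 * inner x y + inner y y = inner (x - y) (x - y)"
    by (simp add: inner_diff_left inner_diff_right inner_commute[of y x])
  finally show "hdist (hilbert_of_type TYPE('h)) x y = dist x y"
    by (simp add: dist_norm norm_eq_sqrt_inner)
qed

theorem real_hilbert_space_of_type: "real_hilbert_space (hilbert_of_type TYPE('h))"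
  for dummy :: "'h :: {real_inner, complete_space}"
proof (intro real_hilbert_space.intro real_hilbert_space_axioms.intro)
  have "Met_TC.mcomplete TYPE('h)"
    by (simp add: mcomplete_iff_complete complete_UNIV)
  then show "Metric_space.mcomplete (carrier (hilbert_of_type TYPE('h)))
      (hdist (hilbert_of_type TYPE('h)))"
    unfolding hdist_of_type by (simp add: hilbert_of_type_def)
qed (rule real_inner_space_of_type)

text \<open>
  Given \<open>F\<close> on \<open>X\<close>, the closed subspace \<open>V\<close> generated by \<open>F ` X\<close>, here written as the
  double orthogonal complement, is transported to functions on \<open>X\<close> along
  \<open>v \<mapsto> (\<lambda>x. ip H v (F x))\<close>.
\<close>

locale transport = real_hilbert_space H
  for H :: "('h, 'b) inner_space_scheme" (structure) +
  fixes X :: "'a set" and F :: "'a \<Rightarrow> 'h"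
  assumes F_in: "x \<in> X \<Longrightarrow> F x \<in> carrier H"
begin

definition V :: "'h set" where
  "V = {v \<in> carrier H. \<forall>w\<in>carrier H. (\<forall>x\<in>X. ip H w (F x) = 0) \<longrightarrow> ip H v w = 0}"

definition \<Phi> :: "'h \<Rightarrow> 'a \<Rightarrow> real" where
  "\<Phi> v = (\<lambda>x. if x \<in> X then ip H v (F x) else 0)"

definition \<Psi> :: "('a \<Rightarrow> real) \<Rightarrow> 'h" where
  "\<Psi> = inv_into V \<Phi>"

definition K :: "('a \<Rightarrow> real) inner_space" where
  "K = \<lparr>carrier = \<Phi> ` V, monoid.mult = (\<lambda>f g. f), one = (\<lambda>x. 0), zero = (\<lambda>x. 0),
        add = (\<lambda>f g x. f x + g x), smult = (\<lambda>a f x. a * f x),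
        ip = (\<lambda>f g. ip H (\<Psi> f) (\<Psi> g))\<rparr>"

lemma V_sub: "v \<in> V \<Longrightarrow> v \<in> carrier H"
  by (simp add: V_def)

lemma V_add: "\<lbrakk>v \<in> V; w \<in> V\<rbrakk> \<Longrightarrow> v \<oplus>\<^bsub>H\<^esub> w \<in> V"
  by (simp add: V_def ip_add_left)

lemma V_smult: "v \<in> V \<Longrightarrow> a \<odot>\<^bsub>H\<^esub> v \<in> V"
  by (simp add: V_def ip_smult_left)

lemma V_zero: "\<zero>\<^bsub>H\<^esub> \<in> V"
  by (simp add: V_def)

lemma V_neg: "v \<in> V \<Longrightarrow> \<ominus>\<^bsub>H\<^esub> v \<in> V"
  by (simp add: V_def ip_neg_left)

lemma V_diff: "\<lbrakk>v \<in> V; w \<in> V\<rbrakk> \<Longrightarrow> v \<ominus>\<^bsub>H\<^esub> w \<in> V"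
  by (simp add: a_minus_def V_add V_neg)

lemma F_in_V: "x \<in> X \<Longrightarrow> F x \<in> V"
  by (auto simp: V_def F_in ip_commute)

lemma \<Phi>_add: "\<lbrakk>v \<in> V; w \<in> V\<rbrakk> \<Longrightarrow> \<Phi> (v \<oplus>\<^bsub>H\<^esub> w) = (\<lambda>x. \<Phi> v x + \<Phi> w x)"
  by (auto simp: \<Phi>_def V_sub F_in ip_add_left)

lemma \<Phi>_smult: "v \<in> V \<Longrightarrow> \<Phi> (a \<odot>\<^bsub>H\<^esub> v) = (\<lambda>x. a * \<Phi> v x)"
  by (auto simp: \<Phi>_def V_sub F_in ip_smult_left)

lemma \<Phi>_zero: "\<Phi> \<zero>\<^bsub>H\<^esub> = (\<lambda>x. 0)"
  by (auto simp: \<Phi>_def F_in)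

lemma \<Phi>_neg: "v \<in> V \<Longrightarrow> \<Phi> (\<ominus>\<^bsub>H\<^esub> v) = (\<lambda>x. - \<Phi> v x)"
  by (auto simp: \<Phi>_def V_sub F_in ip_neg_left)

lemma inj_\<Phi>: "inj_on \<Phi> V"
proof (rule inj_onI)
  fix v w assume vw: "v \<in> V" "w \<in> V" "\<Phi> v = \<Phi> w"
  let ?u = "v \<ominus>\<^bsub>H\<^esub> w"
  have "\<forall>x\<in>X. ip H ?u (F x) = 0"
  proof
    fix x assume "x \<in> X"
    then show "ip H ?u (F x) = 0"
      using fun_cong[OF vw(3), of x] vw(1,2) by (simp add: \<Phi>_def ip_diff_left V_sub F_in)
  qed
  moreover have "?u \<in> V" "?u \<in> carrier H"
    using vw V_diff V_sub by blast+
  ultimately have "ip H ?u ?u = 0"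
    unfolding V_def by blast
  then have "?u = \<zero>\<^bsub>H\<^esub>"
    using \<open>?u \<in> carrier H\<close> ip_eq_zero by blast
  then show "v = w"
    using vw V_sub by (blast intro: eq_if_minus_zero)
qed

lemma \<Psi>_\<Phi> [simp]: "v \<in> V \<Longrightarrow> \<Psi> (\<Phi> v) = v"
  by (simp add: \<Psi>_def inj_\<Phi>)

lemma K_simps:
  "carrier K = \<Phi> ` V" "\<zero>\<^bsub>K\<^esub> = (\<lambda>x. 0)" "f \<oplus>\<^bsub>K\<^esub> g = (\<lambda>x. f x + g x)"
  "a \<odot>\<^bsub>K\<^esub> f = (\<lambda>x. a * f x)" "ip K f g = ip H (\<Psi> f) (\<Psi> g)"
  by (simp_all add: K_def)

lemma abelian_group_K: "abelian_group K"
proof (rule abelian_groupI)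
  fix f g assume "f \<in> carrier K" "g \<in> carrier K"
  then show "f \<oplus>\<^bsub>K\<^esub> g \<in> carrier K"
    by (auto simp: K_simps \<Phi>_add[symmetric] V_add)
next
  show "\<zero>\<^bsub>K\<^esub> \<in> carrier K"
    by (auto simp: K_simps \<Phi>_zero[symmetric] V_zero)
next
  fix f assume "f \<in> carrier K"
  then obtain v where v: "v \<in> V" "f = \<Phi> v" by (auto simp: K_simps)
  show "\<exists>g\<in>carrier K. g \<oplus>\<^bsub>K\<^esub> f = \<zero>\<^bsub>K\<^esub>"
  proof
    show "\<Phi> (\<ominus>\<^bsub>H\<^esub> v) \<in> carrier K"
      using v by (simp only: K_simps V_neg imageI)
    show "\<Phi> (\<ominus>\<^bsub>H\<^esub> v) \<oplus>\<^bsub>K\<^esub> f = \<zero>\<^bsub>K\<^esub>"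
      using v by (simp add: K_simps \<Phi>_neg)
  qed
qed (auto simp: K_simps add.assoc add.commute)

lemma real_inner_space_K: "real_inner_space K"
proof (intro real_inner_space.intro real_inner_space_axioms.intro)
  show "Module.module real_ring K"
  proof (rule Module.moduleI[OF cring_real_ring abelian_group_K])
    fix a f assume "f \<in> carrier K"
    then show "a \<odot>\<^bsub>K\<^esub> f \<in> carrier K"
      by (auto simp: K_simps \<Phi>_smult[symmetric] V_smult)
  qed (auto simp: K_simps distrib_left distrib_right mult.assoc)
next
  fix f assume "f \<in> carrier K" "ip K f f = 0"
  then show "f = \<zero>\<^bsub>K\<^esub>"
    by (auto simp: K_simps \<Phi>_zero[symmetric] intro!: arg_cong[of _ _ \<Phi>] ip_eq_zero V_sub)
next
  fix f g assume "f \<in> carrier K" "g \<in> carrier K"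
  then show "ip K f g = ip K g f"
    by (auto simp: K_simps V_sub intro: ip_commute)
qed (auto simp: K_simps \<Phi>_add[symmetric] \<Phi>_smult[symmetric] V_add V_smult V_sub
      ip_add_left ip_smult_left ip_ge_zero)

sublocale K: real_inner_space K
  by (rule real_inner_space_K)

lemma hdist_K: "\<lbrakk>v \<in> V; w \<in> V\<rbrakk> \<Longrightarrow> hdist K (\<Phi> v) (\<Phi> w) = hdist H v w"
  by (simp add: K.hdist_sq hdist_sq K_simps V_sub)

sublocale MH: Metric_space "carrier H" "hdist H"
  by (rule Metric_space_hdist)

sublocale MK: Metric_space "carrier K" "hdist K"
  by (rule K.Metric_space_hdist)

lemma complete_K: "MK.mcomplete"
  unfolding MK.mcomplete_def
proof (intro allI impI)
  fix \<sigma> assume \<sigma>: "MK.MCauchy \<sigma>"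
  define \<tau> where "\<tau> n = \<Psi> (\<sigma> n)" for n
  have \<tau>V: "\<tau> n \<in> V" and \<sigma>\<tau>: "\<sigma> n = \<Phi> (\<tau> n)" for n
  proof -
    have "\<sigma> n \<in> carrier K"
      using \<sigma> unfolding MK.MCauchy_def by blast
    then have "\<sigma> n \<in> \<Phi> ` V"
      by (simp only: K_simps)
    then show "\<tau> n \<in> V" "\<sigma> n = \<Phi> (\<tau> n)"
      by (auto simp: \<tau>_def)
  qed
  have "MH.MCauchy \<tau>"
    using \<sigma> \<tau>V unfolding MK.MCauchy_def MH.MCauchy_def \<sigma>\<tau> by (auto simp: hdist_K V_sub)
  then obtain l where l: "limitin MH.mtopology \<tau> l sequentially"
    using complete by (auto simp: MH.mcomplete_def)
  then have lH: "l \<in> carrier H"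
    by (simp add: MH.limitin_metric)
  have lim: "(\<lambda>n. hdist H (\<tau> n) l) \<longlonglongrightarrow> 0"
    using l by (simp add: MH.limitin_metric_dist_null)
  have "ip H l w = 0" if w: "w \<in> carrier H" "\<forall>x\<in>X. ip H w (F x) = 0" for w
  proof -
    have "\<bar>ip H l w\<bar> \<le> hdist H (\<tau> n) l * hnorm H w" for n
    proof -
      have "ip H (\<tau> n) w = 0"
        using \<tau>V[of n] w by (auto simp: V_def)
      then have "\<bar>ip H l w\<bar> = \<bar>ip H (\<tau> n \<ominus>\<^bsub>H\<^esub> l) w\<bar>"
        using lH w V_sub[OF \<tau>V] by (simp add: ip_diff_left)
      also have "\<dots> \<le> hdist H (\<tau> n) l * hnorm H w"
        using Cauchy_Schwarz[of "\<tau> n \<ominus>\<^bsub>H\<^esub> l" w] lH w V_sub[OF \<tau>V] by (simp add: hdist_def)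
      finally show ?thesis .
    qed
    moreover have "(\<lambda>n. hdist H (\<tau> n) l * hnorm H w) \<longlonglongrightarrow> 0"
      using tendsto_mult_right[OF lim] by simp
    ultimately have "\<bar>ip H l w\<bar> \<le> 0"
      by (intro LIMSEQ_le_const) auto
    then show ?thesis by simp
  qed
  then have lV: "l \<in> V"
    using lH by (auto simp: V_def)
  have "limitin MK.mtopology \<sigma> (\<Phi> l) sequentially"
    unfolding MK.limitin_metric_dist_null
    using lim lV \<tau>V by (auto simp: \<sigma>\<tau> hdist_K K_simps)
  then show "\<exists>x. limitin MK.mtopology \<sigma> x sequentially"
    by blast
qed

lemma real_hilbert_space_K: "real_hilbert_space K"
  by (intro real_hilbert_space.intro real_hilbert_space_axioms.intro
      real_inner_space_K complete_K)

end

lemma controlled_embedding_transport: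
  fixes H :: "'h inner_space" and X :: "'a set"
  assumes "controlled_embedding \<rho>\<^sub>l \<rho>\<^sub>u X d H F"
  shows "\<exists>(K :: ('a \<Rightarrow> real) inner_space) G. controlled_embedding \<rho>\<^sub>l \<rho>\<^sub>u X d K G"
proof -
  interpret transport H X F
    using assms
    by (auto simp: controlled_embedding_def transport_def transport_axioms_def)
  have "controlled_embedding \<rho>\<^sub>l \<rho>\<^sub>u X d K (\<lambda>x. \<Phi> (F x))"
    using assms real_hilbert_space_K
    by (auto simp: controlled_embedding_def hdist_K F_in_V K_simps)
  then show ?thesis by blast
qed

theorem uniformly_embeddableI:
  fixes H :: "'h inner_space"
  assumes "control_function \<rho>\<^sub>l" "control_function \<rho>\<^sub>u"
    and "controlled_embedding \<rho>\<^sub>l \<rho>\<^sub>u X d H F"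
  shows "uniformly_embeddable X d"
  using assms controlled_embedding_transport[OF assms(3)]
  unfolding uniformly_embeddable_def by blast

theorem equi_uniformly_embeddableI:
  fixes H :: "'i \<Rightarrow> 'h inner_space" and X :: "'i \<Rightarrow> 'a set"
  assumes "control_function \<rho>\<^sub>l" "control_function \<rho>\<^sub>u"
    and "\<And>i. i \<in> I \<Longrightarrow> controlled_embedding \<rho>\<^sub>l \<rho>\<^sub>u (X i) (d i) (H i) (F i)"
  shows "equi_uniformly_embeddable I X d"
proof -
  have "\<forall>i\<in>I. \<exists>K G. controlled_embedding \<rho>\<^sub>l \<rho>\<^sub>u (X i) (d i) (K :: ('a \<Rightarrow> real) inner_space) G"
    using controlled_embedding_transport[OF assms(3)] by blast
  then obtain K G where
    "\<forall>i\<in>I. controlled_embedding \<rho>\<^sub>l \<rho>\<^sub>u (X i) (d i) (K i :: ('a \<Rightarrow> real) inner_space) (G i)"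
    by metis
  with assms(1,2) show ?thesis
    unfolding equi_uniformly_embeddable_def by blast
qed

end

theory Submission
  imports Defs "HOL-Library.Function_Algebras"
begin

text \<open>
  Gaussian kernels \<open>exp (- t \<parallel>F\<^sub>i x - F\<^sub>i y\<parallel>\<^sup>2)\<close> are positive definite, hence so is
  \<open>K x y = (\<Sum>i. sqrt (\<phi>\<^sub>i x) * sqrt (\<phi>\<^sub>i y) * exp (- t \<parallel>F\<^sub>i x - F\<^sub>i y\<parallel>\<^sup>2))\<close>. It is 1 on the diagonal, takes
  values in \<open>[0, 1]\<close>, tends to 0 uniformly as \<open>d x y \<rightarrow> \<infinity>\<close>, and for small \<open>t\<close> is close to 1 where
  \<open>d x y \<le> R\<close>. With such kernels \<open>K\<^sub>n\<close> for \<open>R = n + 1\<close> and \<open>\<epsilon> = 2\<^sup>-\<^sup>n\<close>, the series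
  \<open>N x y = (\<Sum>n. 1 - K\<^sub>n x y)\<close> converges, grows at most linearly in \<open>d x y\<close>, tends to infinity with
  \<open>d x y\<close>, and is half the squared distance of the images of \<open>x\<close> and \<open>y\<close> in the Hilbert space with
  reproducing kernel \<open>N x z + N y z - N x y\<close>, for any base point \<open>z\<close>.
\<close>

section \<open>Positive definite kernels\<close>

text \<open>A list of pairs \<open>(c, x)\<close> stands for the formal linear combination of points \<open>\<Sum>c x\<close>.\<close>

definition ev :: "('a \<Rightarrow> real) \<Rightarrow> (real \<times> 'a) list \<Rightarrow> real" where
  "ev f e = (\<Sum>(c, x)\<leftarrow>e. c * f x)"

definition qform :: "('a \<Rightarrow> 'a \<Rightarrow> real) \<Rightarrow> (real \<times> 'a) list \<Rightarrow> real" where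
  "qform k e = ev (\<lambda>x. ev (k x) e) e"

definition scale_comb :: "real \<Rightarrow> (real \<times> 'a) list \<Rightarrow> (real \<times> 'a) list" where
  "scale_comb a e = map (\<lambda>(c, x). (a * c, x)) e"

text \<open>Points may repeat in \<open>e\<close>, so combinations are added by \<open>@\<close> and
  induction peels off one point at a time. Kernels live on the whole type; one given only on a
  subset is extended by 0.\<close>

definition pd_kernel :: "('a \<Rightarrow> 'a \<Rightarrow> real) \<Rightarrow> bool" where
  "pd_kernel k \<longleftrightarrow> (\<forall>x y. k x y = k y x) \<and> (\<forall>e. 0 \<le> qform k e)"

lemma pd_kernelI:
  "\<lbrakk>\<And>x y. k x y = k y x; \<And>e. 0 \<le> qform k e\<rbrakk> \<Longrightarrow> pd_kernel k"
  by (simp add: pd_kernel_def)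

lemma pd_kernel_sym: "pd_kernel k \<Longrightarrow> k x y = k y x"
  by (simp add: pd_kernel_def)

lemma qform_nonneg: "pd_kernel k \<Longrightarrow> 0 \<le> qform k e"
  by (simp add: pd_kernel_def)

section \<open>Calculus of evaluations and quadratic forms\<close>

lemma ev_Nil [simp]: "ev f [] = 0"
  and ev_Cons [simp]: "ev f ((c, x) # e) = c * f x + ev f e"
  and ev_append [simp]: "ev f (e @ e') = ev f e + ev f e'"
  by (simp_all add: ev_def)

lemma ev_scale_comb [simp]: "ev f (scale_comb a e) = a * ev f e"
  by (induction e) (auto simp: scale_comb_def ev_def algebra_simps)

lemma ev_add: "ev (\<lambda>x. f x + g x) e = ev f e + ev g e"
  by (induction e) (auto simp: algebra_simps)

lemma ev_diff: "ev (\<lambda>x. f x - g x) e = ev f e - ev g e"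
  by (induction e) (auto simp: algebra_simps)

lemma ev_cmult: "ev (\<lambda>x. a * f x) e = a * ev f e"
  by (induction e) (auto simp: algebra_simps)

lemma ev_multc: "ev (\<lambda>x. f x * a) e = ev f e * a"
  by (induction e) (auto simp: algebra_simps)

lemma ev_zero [simp]: "ev (\<lambda>x. 0) e = 0"
  using ev_cmult[of 0 "\<lambda>x. 0"] by simp

lemma ev_swap: "ev (\<lambda>x. ev (k x) e') e = ev (\<lambda>y. ev (\<lambda>x. k x y) e) e'"
  by (induction e) (auto simp: ev_add ev_cmult)

lemma ev_map: "ev f (map (\<lambda>(c, x). (c * b x, h x)) e) = ev (\<lambda>x. b x * f (h x)) e"
  by (induction e) auto

lemma tendsto_ev:
  "(\<And>x. ((\<lambda>n. f n x) \<longlongrightarrow> g x) F) \<Longrightarrow> ((\<lambda>n. ev (f n) e) \<longlongrightarrow> ev g e) F"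
  by (induction e) (auto intro!: tendsto_intros)

lemma qform_Nil [simp]: "qform k [] = 0"
  by (simp add: qform_def)

lemma qform_append:
  assumes "\<And>x y. k x y = k y x"
  shows "qform k (e @ e') = qform k e + 2 * ev (\<lambda>x. ev (k x) e') e + qform k e'"
proof -
  have "ev (\<lambda>x. ev (k x) e) e' = ev (\<lambda>x. ev (k x) e') e"
    using ev_swap[of k e' e] assms by (metis (no_types, lifting) ext)
  then show ?thesis
    by (simp add: qform_def ev_add)
qed

lemma qform_scale_comb [simp]: "qform k (scale_comb a e) = a\<^sup>2 * qform k e"
  by (simp add: qform_def ev_cmult power2_eq_square)

lemma qform_add: "qform (\<lambda>x y. k x y + k' x y) e = qform k e + qform k' e"
  by (simp add: qform_def ev_add)

lemma qform_cmult: "qform (\<lambda>x y. a * k x y) e = a * qform k e"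
  by (simp add: qform_def ev_cmult)

lemma qform_rank_one: "qform (\<lambda>x y. b x * b y) e = (ev b e)\<^sup>2"
  by (simp add: qform_def ev_cmult ev_multc power2_eq_square)

lemma qform_pullback:
  "qform (\<lambda>x y. b x * b y * k (h x) (h y)) e =
     qform k (map (\<lambda>(c, x). (c * b x, h x)) e)"
  by (simp add: qform_def ev_map ev_cmult mult.assoc)

section \<open>Closure of positive definite kernels under sums, weights and limits\<close>

lemma pd_kernel_add:
  "\<lbrakk>pd_kernel k; pd_kernel k'\<rbrakk> \<Longrightarrow> pd_kernel (\<lambda>x y. k x y + k' x y)"
  by (simp add: pd_kernel_def qform_add)

lemma pd_kernel_cmult:
  "\<lbrakk>pd_kernel k; 0 \<le> a\<rbrakk> \<Longrightarrow> pd_kernel (\<lambda>x y. a * k x y)"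
  by (simp add: pd_kernel_def qform_cmult)

lemma pd_kernel_rank_one: "pd_kernel (\<lambda>x y. b x * b y)"
  by (simp add: pd_kernel_def qform_rank_one mult.commute)

lemma pd_kernel_zero: "pd_kernel (\<lambda>x y. 0)"
  using pd_kernel_rank_one[of "\<lambda>x. 0"] by simp

text \<open>The weights are absorbed into the coefficients. With an indicator function as
  \<open>b\<close> this also cuts a kernel down to a subset.\<close>

lemma pd_kernel_pullback:
  assumes "pd_kernel k"
  shows "pd_kernel (\<lambda>x y. b x * b y * k (h x) (h y))"
proof (rule pd_kernelI)
  show "b x * b y * k (h x) (h y) = b y * b x * k (h y) (h x)" for x y
    using pd_kernel_sym[OF assms] by (simp add: mult.commute)
qed (use assms in \<open>simp add: qform_pullback qform_nonneg\<close>)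

lemma pd_kernel_sum:
  "(\<And>i. i \<in> A \<Longrightarrow> pd_kernel (k i)) \<Longrightarrow> pd_kernel (\<lambda>x y. \<Sum>i\<in>A. k i x y)"
  by (induction A rule: infinite_finite_induct) (auto intro: pd_kernel_zero pd_kernel_add)

text \<open>For fixed \<open>e\<close> the form involves finitely many kernel values, so its sign
  passes to pointwise limits. A general filter covers both series and unordered sums.\<close>

lemma pd_kernel_limit:
  assumes "F \<noteq> bot" "\<forall>\<^sub>F n in F. pd_kernel (k n)"
    and lim: "\<And>x y. ((\<lambda>n. k n x y) \<longlongrightarrow> l x y) F"
  shows "pd_kernel l"
proof (rule pd_kernelI)
  fix x y
  have "((\<lambda>n. k n x y) \<longlongrightarrow> l y x) F"
    using lim[of y x]
    by (rule Lim_transform_eventually)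
      (use assms(2) in \<open>auto elim!: eventually_mono intro: pd_kernel_sym\<close>)
  then show "l x y = l y x"
    using lim[of x y] assms(1) tendsto_unique by blast
next
  fix e
  have "((\<lambda>n. qform (k n) e) \<longlongrightarrow> qform l e) F"
    unfolding qform_def by (intro tendsto_ev lim)
  then show "0 \<le> qform l e"
    by (rule tendsto_lowerbound)
      (use assms(1,2) in \<open>auto elim!: eventually_mono intro: qform_nonneg\<close>)
qed

lemma pd_kernel_has_sum:
  assumes "\<And>i. i \<in> A \<Longrightarrow> pd_kernel (k i)"
    and "\<And>x y. ((\<lambda>i. k i x y) has_sum l x y) A"
  shows "pd_kernel l"
  using assms by (intro pd_kernel_limit[of "finite_subsets_at_top A" "\<lambda>S x y. \<Sum>i\<in>S. k i x y"])
    (auto simp: has_sum_def intro!: eventually_finite_subsets_at_top_weakI pd_kernel_sum)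

lemma pd_kernel_sums:
  assumes "\<And>n. pd_kernel (k n)" and "\<And>x y. (\<lambda>n. k n x y) sums l x y"
  shows "pd_kernel l"
  using assms by (intro pd_kernel_limit[of sequentially "\<lambda>N x y. \<Sum>n<N. k n x y"])
    (auto simp: sums_def intro!: always_eventually pd_kernel_sum)

section \<open>Schur complements and the Schur product theorem\<close>

lemma pd_kernel_diag_nonneg:
  assumes "pd_kernel k" shows "0 \<le> k x x"
  using qform_nonneg[OF assms, of "[(1, x)]"] by (simp add: qform_def)

text \<open>Degenerate Cauchy-Schwarz: if \<open>k x x = 0\<close>, the form of
  \<open>[(t, x), (1, y)]\<close> is affine in \<open>t\<close>, and a nonzero slope would make it
  negative somewhere.\<close>

lemma pd_kernel_diag_zero:
  assumes "pd_kernel k" "k x x = 0" shows "k x y = 0"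
proof (rule ccontr)
  assume nz: "k x y \<noteq> 0"
  define t where "t = - (k y y + 1) / (2 * k x y)"
  have "0 \<le> qform k [(t, x), (1, y)]"
    by (rule qform_nonneg[OF assms(1)])
  also have "\<dots> = 2 * t * k x y + k y y"
    using assms(2) pd_kernel_sym[OF assms(1), of y x] by (simp add: qform_def)
  also have "\<dots> = -1"
    using nz by (simp add: t_def field_simps)
  finally show False by simp
qed

text \<open>
  One step of the Cholesky decomposition. If \<open>k z z = 0\<close> then the subtracted term is 0, both by
  the convention for division and because \<open>k x z = 0\<close>.
\<close>

definition schur_complement :: "'a \<Rightarrow> ('a \<Rightarrow> 'a \<Rightarrow> real) \<Rightarrow> 'a \<Rightarrow> 'a \<Rightarrow> real" where
  "schur_complement z k x y = k x y - k x z * k y z / k z z"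

lemma schur_complement_vanishes:
  assumes "pd_kernel k"
  shows "schur_complement z k z y = 0" "schur_complement z k y z = 0"
  using pd_kernel_diag_zero[OF assms, of z y] pd_kernel_sym[OF assms, of y z]
  by (auto simp: schur_complement_def)

lemma pd_kernel_schur_complement:
  assumes "pd_kernel k"
  shows "pd_kernel (schur_complement z k)"
proof (rule pd_kernelI)
  show "schur_complement z k x y = schur_complement z k y x" for x y
    using pd_kernel_sym[OF assms] by (simp add: schur_complement_def mult.commute)
next
  fix e
  let ?b = "\<lambda>x. k x z"
  have eq: "qform (schur_complement z k) e = qform k e - (ev ?b e)\<^sup>2 / k z z"
  proof -
    have "qform (schur_complement z k) e = qform (\<lambda>x y. k x y + (- 1 / k z z) * (?b x * ?b y)) e"
      by (simp add: schur_complement_def[abs_def])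
    also have "\<dots> = qform k e - (ev ?b e)\<^sup>2 / k z z"
      unfolding qform_add qform_cmult qform_rank_one by simp
    finally show ?thesis .
  qed
  show "0 \<le> qform (schur_complement z k) e"
  proof (cases "k z z = 0")
    case True
    then show ?thesis using eq qform_nonneg[OF assms] by simp
  next
    case False
    \<comment> \<open>The minimiser of \<open>qform k (e @ [(s, z)])\<close> over \<open>s\<close>;
      the minimum is the form of the Schur complement.\<close>
    define s where "s = - ev ?b e / k z z"
    have "0 \<le> qform k (e @ [(s, z)])"
      by (rule qform_nonneg[OF assms])
    also have "\<dots> = qform k e + 2 * s * ev ?b e + s\<^sup>2 * k z z"
      using pd_kernel_sym[OF assms]
      by (simp add: qform_append ev_cmult) (simp add: qform_def power2_eq_square)
    also have "\<dots> = qform (schur_complement z k) e"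
      using False unfolding eq by (simp add: s_def field_simps power2_eq_square)
    finally show ?thesis .
  qed
qed

text \<open>Schur product theorem. At the first point \<open>z\<close> of the list, \<open>k\<close>
  is its Schur complement plus a rank-one kernel. The rank-one part only puts weights on
  \<open>k'\<close>. The complement vanishes as soon as one argument is \<open>z\<close>, so this
  point drops out and the induction hypothesis applies with the complement as
  \<open>k\<close>.\<close>

theorem pd_kernel_mult:
  assumes "pd_kernel k" "pd_kernel k'"
  shows "pd_kernel (\<lambda>x y. k x y * k' x y)"
proof (rule pd_kernelI)
  show "k x y * k' x y = k y x * k' y x" for x y
    using assms pd_kernel_sym by metis
next
  fix e
  show "0 \<le> qform (\<lambda>x y. k x y * k' x y) e"
    using assms(1)
  proof (induction e arbitrary: k)
    case (Cons p e)
    obtain c z where p: "p = (c, z)" by (cases p)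
    let ?s = "schur_complement z k"
    let ?b = "\<lambda>x. k x z / sqrt (k z z)"
    have "k x y * k' x y = ?s x y * k' x y + ?b x * ?b y * k' x y" for x y
      using pd_kernel_diag_nonneg[OF Cons.prems, of z]
      by (simp add: schur_complement_def left_diff_distrib)
    then have "qform (\<lambda>x y. k x y * k' x y) (p # e) =
        qform (\<lambda>x y. ?s x y * k' x y + ?b x * ?b y * k' x y) (p # e)"
      by (intro arg_cong[of _ _ "\<lambda>k. qform k (p # e)"] ext)
    also have "\<dots> = qform (\<lambda>x y. ?s x y * k' x y) (p # e)
        + qform (\<lambda>x y. ?b x * ?b y * k' x y) (p # e)"
      by (rule qform_add)
    also have "qform (\<lambda>x y. ?s x y * k' x y) (p # e) = qform (\<lambda>x y. ?s x y * k' x y) e"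
      by (simp add: p qform_def schur_complement_vanishes[OF Cons.prems])
    finally show ?case
      using Cons.IH[OF pd_kernel_schur_complement[OF Cons.prems, of z]]
        qform_nonneg[OF pd_kernel_pullback[OF assms(2), of ?b "\<lambda>x. x"], of "p # e"]
      by linarith
  qed simp
qed

lemma pd_kernel_power: "pd_kernel k \<Longrightarrow> pd_kernel (\<lambda>x y. k x y ^ n)"
  by (induction n) (use pd_kernel_rank_one[of "\<lambda>x. 1"] in \<open>auto intro: pd_kernel_mult\<close>)

lemma pd_kernel_exp:
  assumes "pd_kernel k" shows "pd_kernel (\<lambda>x y. exp (k x y))"
proof (rule pd_kernel_sums)
  show "(\<lambda>n. inverse (fact n) * k x y ^ n) sums exp (k x y)" for x y
    using exp_converges[of "k x y"] by simp
qed (intro pd_kernel_cmult pd_kernel_power assms; simp)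

text \<open>If \<open>k\<close> is the Gram kernel of \<open>\<psi>\<close>, this is the Gram kernel of \<open>\<psi> x - \<psi> z\<close>.\<close>

lemma pd_kernel_centered:
  fixes k :: "'a \<Rightarrow> 'a \<Rightarrow> real"
  assumes "pd_kernel k" "k z z = 1"
  shows "pd_kernel (\<lambda>x y. 1 - k x z - k y z + k x y)"
proof (rule pd_kernelI)
  show "1 - k x z - k y z + k x y = 1 - k y z - k x z + k y x" for x y
    using pd_kernel_sym[OF assms(1), of x y] by simp
next
  fix e :: "(real \<times> 'a) list"
  let ?s = "ev (\<lambda>x. 1) e"
  \<comment> \<open>Subtracting the total mass of \<open>e\<close> at \<open>z\<close> replaces
    every \<open>\<psi> x\<close> by \<open>\<psi> x - \<psi> z\<close>.\<close>
  have "0 \<le> qform k (e @ [(- ?s, z)])"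
    by (rule qform_nonneg[OF assms(1)])
  also have "\<dots> = qform k e - 2 * ?s * ev (\<lambda>x. k x z) e + ?s\<^sup>2"
    using pd_kernel_sym[OF assms(1)] ev_cmult[of "- ?s" "\<lambda>x. k x z" e]
    by (simp add: qform_append) (simp add: qform_def power2_eq_square assms(2))
  also have "\<dots> = qform (\<lambda>x y. 1 - k x z - k y z + k x y) e"
  proof -
    have "ev (\<lambda>y. 1 - k x z - k y z + k x y) e
        = (1 - k x z) * ?s - ev (\<lambda>y. k y z) e + ev (k x) e" for x
      using ev_cmult[of "1 - k x z" "\<lambda>y. 1" e] by (simp add: ev_add ev_diff)
    then show ?thesis
      using ev_cmult[of "ev (\<lambda>y. k y z) e" "\<lambda>y. 1" e] ev_cmult[of ?s "\<lambda>y. 1" e]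
      by (simp add: qform_def ev_add ev_diff ev_multc power2_eq_square left_diff_distrib)
  qed
  finally show "0 \<le> qform (\<lambda>x y. 1 - k x z - k y z + k x y) e" .
qed

section \<open>Gram kernels and Gaussian kernels\<close>

lemma (in real_inner_space) pd_kernel_ip:
  assumes "F \<in> X \<rightarrow> carrier H"
  shows "pd_kernel (\<lambda>x y. if x \<in> X \<and> y \<in> X then ip H (F x) (F y) else 0)"
proof (rule pd_kernelI)
  show "(if x \<in> X \<and> y \<in> X then ip H (F x) (F y) else 0) =
      (if y \<in> X \<and> x \<in> X then ip H (F y) (F x) else 0)" for x y
    using assms by (auto intro: ip_commute)
next
  fix e
  \<comment> \<open>\<open>v\<close> is the linear combination of the vectors \<open>F x\<close>
    encoded by \<open>e\<close>, described through its inner products; the form will be its squared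
    norm.\<close>
  have "\<exists>v\<in>carrier H. \<forall>w\<in>carrier H. ip H v w = ev (\<lambda>x. if x \<in> X then ip H (F x) w else 0) e"
  proof (induction e)
    case Nil
    then show ?case by (auto intro!: bexI[of _ "\<zero>\<^bsub>H\<^esub>"])
  next
    case (Cons p e)
    then obtain v where v: "v \<in> carrier H"
      "\<And>w. w \<in> carrier H \<Longrightarrow> ip H v w = ev (\<lambda>x. if x \<in> X then ip H (F x) w else 0) e"
      by blast
    obtain c x where p: "p = (c, x)" by (cases p)
    show ?case
    proof (cases "x \<in> X")
      case True
      with assms have "F x \<in> carrier H" by auto
      with v True p show ?thesis
        by (intro bexI[of _ "c \<odot>\<^bsub>H\<^esub> F x \<oplus>\<^bsub>H\<^esub> v"]) (auto simp: ip_add_left ip_smult_left)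
    qed (use v p in auto)
  qed
  then obtain v where v: "v \<in> carrier H"
    "\<And>w. w \<in> carrier H \<Longrightarrow> ip H v w = ev (\<lambda>x. if x \<in> X then ip H (F x) w else 0) e"
    by blast
  have "ev (\<lambda>y. if x \<in> X \<and> y \<in> X then ip H (F x) (F y) else 0) e
      = (if x \<in> X then ip H (F x) v else 0)" for x
  proof (cases "x \<in> X")
    case True
    with assms have x: "F x \<in> carrier H" by auto
    have "ip H (F x) v = ip H v (F x)"
      using x v(1) by (rule ip_commute)
    also have "\<dots> = ev (\<lambda>y. if y \<in> X then ip H (F y) (F x) else 0) e"
      by (rule v(2)[OF x])
    also have "(\<lambda>y. if y \<in> X then ip H (F y) (F x) else 0) =
        (\<lambda>y. if y \<in> X then ip H (F x) (F y) else 0)"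
      using assms x by (intro ext if_cong refl ip_commute) auto
    finally show ?thesis using True by simp
  qed simp
  then have "qform (\<lambda>x y. if x \<in> X \<and> y \<in> X then ip H (F x) (F y) else 0) e = ip H v v"
    using v by (simp add: qform_def)
  then show "0 \<le> qform (\<lambda>x y. if x \<in> X \<and> y \<in> X then ip H (F x) (F y) else 0) e"
    using ip_ge_zero[OF v(1)] by simp
qed

text \<open>Expanding the squared distance splits the Gaussian into a weight in \<open>x\<close>, a
  weight in \<open>y\<close> and the exponential of a multiple of the Gram kernel.\<close>

lemma (in real_inner_space) pd_kernel_gaussian:
  assumes F: "F \<in> X \<rightarrow> carrier H" and t: "0 \<le> t"
  shows "pd_kernel (\<lambda>x y. if x \<in> X \<and> y \<in> X then exp (- t * (hdist H (F x) (F y))\<^sup>2) else 0)"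
proof -
  define k where "k x y = (if x \<in> X \<and> y \<in> X then ip H (F x) (F y) else 0)" for x y
  define b where "b x = (if x \<in> X then exp (- t * ip H (F x) (F x)) else 0)" for x
  have eq: "(if x \<in> X \<and> y \<in> X then exp (- t * (hdist H (F x) (F y))\<^sup>2) else 0) =
      b x * b y * exp (2 * t * k x y)" for x y
  proof (cases "x \<in> X \<and> y \<in> X")
    case True
    with F have xy: "F x \<in> carrier H" "F y \<in> carrier H" by auto
    have "(hdist H (F x) (F y))\<^sup>2 = ip H (F x) (F x) - 2 * ip H (F x) (F y) + ip H (F y) (F y)"
      using xy ip_ge_zero[OF minus_in[OF xy]]
      by (simp add: hdist_sq ip_diff_left ip_diff_right ip_commute[of "F y" "F x"])
    then have "- t * (hdist H (F x) (F y))\<^sup>2 =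
        - t * ip H (F x) (F x) + - t * ip H (F y) (F y) + 2 * t * ip H (F x) (F y)"
      by (simp only:) (simp add: algebra_simps)
    with True show ?thesis
      by (simp add: b_def k_def mult_exp_exp)
  qed (auto simp: b_def)
  have "pd_kernel (\<lambda>x y. exp (2 * t * k x y))"
    using t pd_kernel_ip[OF F] by (intro pd_kernel_exp pd_kernel_cmult) (auto simp: k_def[abs_def])
  from pd_kernel_pullback[OF this, of b "\<lambda>x. x"] show ?thesis
    by (simp only: eq)
qed

section \<open>The reproducing kernel Hilbert space\<close>

text \<open>The parallelogram law makes the polarised form additive: of its four instances below,
  the first two minus the last two give twice the claim, as evenness cancels the mixed
  terms.\<close>

lemma jordan_von_neumann:
  fixes Q :: "'v :: ab_group_add \<Rightarrow> real"
  assumes add: "\<And>u v. \<lbrakk>u \<in> C; v \<in> C\<rbrakk> \<Longrightarrow> u + v \<in> C"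
    and minus: "\<And>u. u \<in> C \<Longrightarrow> - u \<in> C"
    and Q_minus: "\<And>u. u \<in> C \<Longrightarrow> Q (- u) = Q u"
    and Q: "\<And>u v. \<lbrakk>u \<in> C; v \<in> C\<rbrakk> \<Longrightarrow> Q (u + v) + Q (u - v) = 2 * Q u + 2 * Q v"
    and "f \<in> C" "g \<in> C" "h \<in> C"
  shows "Q (f + g + h) - Q (f + g - h) = (Q (f + h) - Q (f - h)) + (Q (g + h) - Q (g - h))"
proof -
  have diff: "u - v \<in> C" if "u \<in> C" "v \<in> C" for u v
    using add[OF that(1) minus[OF that(2)]] by simp
  have "Q (f + h + g) + Q (f + h - g) = 2 * Q (f + h) + 2 * Q g"
    "Q (g + h + f) + Q (g + h - f) = 2 * Q (g + h) + 2 * Q f"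
    "Q (f - h + g) + Q (f - h - g) = 2 * Q (f - h) + 2 * Q g"
    "Q (g - h + f) + Q (g - h - f) = 2 * Q (g - h) + 2 * Q f"
    by (rule Q; use assms(5-7) in \<open>blast intro: add diff\<close>)+
  moreover have "f + h + g = f + g + h" "g + h + f = f + g + h" "f - h + g = f + g - h"
    "g - h + f = f + g - h"
    by (simp_all add: algebra_simps)
  moreover have "Q (f - h - g) = Q (g + h - f)" "Q (g - h - f) = Q (f + h - g)"
    using Q_minus[of "g + h - f"] Q_minus[of "f + h - g"] assms(5-7)
    by (simp_all add: add diff algebra_simps)
  ultimately show ?thesis by simp
qed

text \<open>Subtracting the linear map with the same value at 1 leaves an additive \<open>D\<close>
  that vanishes on the integers. It has period 1, so it is bounded everywhere, and
  \<open>D (n * t) = n * D t\<close> forces it to be 0.\<close>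

lemma additive_bounded_imp_linear:
  fixes A :: "real \<Rightarrow> real"
  assumes "\<And>s t. A (s + t) = A s + A t" and bound: "\<And>t. \<lbrakk>0 \<le> t; t \<le> 1\<rbrakk> \<Longrightarrow> \<bar>A t\<bar> \<le> M"
  shows "A t = t * A 1"
proof -
  define D where "D s = A s - s * A 1" for s
  interpret D: additive D
    by standard (simp add: D_def assms(1) algebra_simps)
  have nat: "D (real n * s) = real n * D s" for n s
    by (induction n) (simp_all add: D.zero D.add distrib_right)
  have "D 1 = 0"
    by (simp add: D_def)
  then have "D (of_int m) = 0" for m
    using nat[of _ 1] D.minus[of "real _"] by (cases m rule: int_cases2) auto
  then have "D s = D (frac s)" for s
    using D.add[of "of_int \<lfloor>s\<rfloor>" "frac s"] by (simp add: frac_def)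
  moreover have "\<bar>D (frac s)\<bar> \<le> M + \<bar>A 1\<bar>" for s
  proof -
    have "\<bar>frac s * A 1\<bar> \<le> 1 * \<bar>A 1\<bar>"
      unfolding abs_mult using frac_lt_1[of s] by (intro mult_right_mono) auto
    then show ?thesis
      using bound[of "frac s"] frac_lt_1[of s] by (simp add: D_def)
  qed
  ultimately have bounded: "real n * \<bar>D t\<bar> \<le> M + \<bar>A 1\<bar>" for n
    using nat[of n t] by (metis abs_mult abs_of_nat)
  have "D t = 0"
  proof (rule ccontr)
    assume "D t \<noteq> 0"
    then obtain n where "M + \<bar>A 1\<bar> < real n * \<bar>D t\<bar>"
      using reals_Archimedean3[of "\<bar>D t\<bar>"] by auto
    with bounded[of n] show False by simp
  qed
  then show ?thesis by (simp add: D_def)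
qed

locale kernel_space =
  fixes k :: "'a \<Rightarrow> 'a \<Rightarrow> real"
  assumes pd: "pd_kernel k"
begin

text \<open>
  For a bounded linear functional \<open>f\<close> on a space with inner product,
  \<open>\<parallel>f\<parallel>\<^sup>2 = sup (2 f e - \<parallel>e\<parallel>\<^sup>2)\<close>. Here the space consists of the formal linear combinations of points,
  with the inner product given by \<open>k\<close>.
\<close>

definition gap :: "('a \<Rightarrow> real) \<Rightarrow> (real \<times> 'a) list \<Rightarrow> real" where
  "gap f e = 2 * ev f e - qform k e"

text \<open>The reproducing kernel Hilbert space of \<open>k\<close>, obtained directly as a set of
  functions instead of by completing a quotient of the formal combinations.\<close>

definition C :: "('a \<Rightarrow> real) set" where
  "C = {f. bdd_above (range (gap f))}"

definition Q :: "('a \<Rightarrow> real) \<Rightarrow> real" where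
  "Q f = (SUP e. gap f e)"

lemma gap_le_Q: "f \<in> C \<Longrightarrow> gap f e \<le> Q f"
  unfolding Q_def C_def by (auto intro: cSUP_upper)

lemma C_I: "(\<And>e. gap f e \<le> M) \<Longrightarrow> f \<in> C"
  unfolding C_def by (auto simp: bdd_above_def)

lemma Q_le: "(\<And>e. gap f e \<le> M) \<Longrightarrow> Q f \<le> M"
  unfolding Q_def by (auto intro: cSUP_least)

lemma Q_nonneg: "f \<in> C \<Longrightarrow> 0 \<le> Q f"
  using gap_le_Q[of f "[]"] by (simp add: gap_def)

text \<open>With \<open>?u\<close> and \<open>?v\<close> half the sum and half the difference of
  \<open>e\<close> and \<open>e'\<close>, the left side equals
  \<open>2 * gap f ?u + 2 * gap g ?v\<close>. As \<open>e\<close> and \<open>e'\<close> are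
  independent, both suprema can then be taken.\<close>

lemma gap_parallelogram: "gap (f + g) e + gap (f - g) e' \<le> 2 * Q f + 2 * Q g"
  if "f \<in> C" "g \<in> C"
proof -
  let ?u = "scale_comb (1/2) (e @ e')" and ?v = "scale_comb (1/2) (e @ scale_comb (-1) e')"
  have "ev (\<lambda>x. ev (k x) (scale_comb (-1) e')) e = - ev (\<lambda>x. ev (k x) e') e"
    using ev_cmult[of "-1" "\<lambda>x. ev (k x) e'" e] by simp
  then have "gap (f + g) e + gap (f - g) e' = 2 * gap f ?u + 2 * gap g ?v"
    using qform_append[of k e e', OF pd_kernel_sym[OF pd]]
      qform_append[of k e "scale_comb (-1) e'", OF pd_kernel_sym[OF pd]]
    by (simp add: gap_def plus_fun_def fun_diff_def ev_add ev_diff power2_eq_square)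
      (simp add: field_simps)
  then show ?thesis
    using gap_le_Q[OF that(1), of ?u] gap_le_Q[OF that(2), of ?v] by linarith
qed

lemma C_add: "\<lbrakk>f \<in> C; g \<in> C\<rbrakk> \<Longrightarrow> f + g \<in> C"
  using gap_parallelogram[of f g _ "[]"] by (intro C_I[of _ "2 * Q f + 2 * Q g"]) (simp add: gap_def)

lemma gap_cmult_le: "gap (\<lambda>x. a * f x) e \<le> a\<^sup>2 * Q f" if "f \<in> C"
proof (cases "a = 0")
  case True
  then show ?thesis using qform_nonneg[OF pd] by (simp add: gap_def)
next
  case False
  then have "gap (\<lambda>x. a * f x) e = a\<^sup>2 * gap f (scale_comb (1 / a) e)"
    by (simp add: gap_def ev_cmult field_simps power2_eq_square)
  then show ?thesis
    using gap_le_Q[OF that] by (simp add: mult_left_mono)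
qed

lemma C_cmult: "f \<in> C \<Longrightarrow> (\<lambda>x. a * f x) \<in> C"
  using gap_cmult_le by (rule C_I)

lemma C_minus: "f \<in> C \<Longrightarrow> - f \<in> C"
  using C_cmult[of f "-1"] by (simp add: fun_Compl_def)

lemma C_diff: "\<lbrakk>f \<in> C; g \<in> C\<rbrakk> \<Longrightarrow> f - g \<in> C"
  using C_add[of f "- g"] C_minus[of g] by simp

lemma C_zero: "0 \<in> C"
  using qform_nonneg[OF pd] by (intro C_I[of _ 0]) (simp add: gap_def zero_fun_def)

lemma Q_cmult: "Q (\<lambda>x. a * f x) = a\<^sup>2 * Q f" if "f \<in> C"
proof (rule antisym)
  show "Q (\<lambda>x. a * f x) \<le> a\<^sup>2 * Q f"
    using gap_cmult_le[OF that] by (rule Q_le)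
  show "a\<^sup>2 * Q f \<le> Q (\<lambda>x. a * f x)"
  proof (cases "a = 0")
    case True
    then show ?thesis using Q_nonneg[OF C_cmult[OF that, of a]] by simp
  next
    case False
    have "Q f \<le> (1 / a)\<^sup>2 * Q (\<lambda>x. a * f x)"
      using gap_cmult_le[OF C_cmult[OF that], of "1 / a" a] False by (intro Q_le) simp
    with False show ?thesis by (simp add: field_simps)
  qed
qed

lemma Q_minus: "f \<in> C \<Longrightarrow> Q (- f) = Q f"
  using Q_cmult[of f "-1"] by (simp add: fun_Compl_def)

lemma Q_double: "f \<in> C \<Longrightarrow> Q (f + f) = 4 * Q f"
  using Q_cmult[of f 2] by (simp add: plus_fun_def)

lemma parallelogram: "Q (f + g) + Q (f - g) = 2 * Q f + 2 * Q g" if "f \<in> C" "g \<in> C"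
proof -
  have le: "Q (f + g) + Q (f - g) \<le> 2 * Q f + 2 * Q g" if "f \<in> C" "g \<in> C" for f g
  proof -
    have "Q (f + g) \<le> 2 * Q f + 2 * Q g - gap (f - g) e'" for e'
      using gap_parallelogram[OF that, of _ e'] by (intro Q_le) (simp add: le_diff_eq)
    then have "Q (f - g) \<le> 2 * Q f + 2 * Q g - Q (f + g)"
      by (intro Q_le) (simp add: le_diff_eq add.commute)
    then show ?thesis by simp
  qed
  \<comment> \<open>Substituting \<open>f + g\<close> and \<open>f - g\<close> into
    \<open>le\<close> gives the reverse inequality.\<close>
  have "(f + g) + (f - g) = f + f" "(f + g) - (f - g) = g + g"
    by (simp_all add: algebra_simps)
  then have "4 * Q f + 4 * Q g \<le> 2 * Q (f + g) + 2 * Q (f - g)"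
    using le[OF C_add C_diff, OF that that] Q_double that by simp
  with le[OF that] show ?thesis by simp
qed

definition B :: "('a \<Rightarrow> real) \<Rightarrow> ('a \<Rightarrow> real) \<Rightarrow> real" where
  "B f g = (Q (f + g) - Q (f - g)) / 4"

lemma B_commute: "\<lbrakk>f \<in> C; g \<in> C\<rbrakk> \<Longrightarrow> B f g = B g f"
  using Q_minus[OF C_diff, of f g] by (simp add: B_def add.commute)

lemma B_add: "\<lbrakk>f \<in> C; g \<in> C; h \<in> C\<rbrakk> \<Longrightarrow> B (f + g) h = B f h + B g h"
  using jordan_von_neumann[of C Q f g h] C_add C_minus Q_minus parallelogram
  by (simp add: B_def add_divide_distrib)

lemma Q_zero: "Q 0 = 0"
  using Q_cmult[OF C_zero, of 0] by (simp add: zero_fun_def)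

lemma B_self: "f \<in> C \<Longrightarrow> B f f = Q f"
  using Q_double[of f] Q_zero by (simp add: B_def)

lemma Q_diff: "\<lbrakk>f \<in> C; g \<in> C\<rbrakk> \<Longrightarrow> Q (f - g) = Q f - 2 * B f g + Q g"
  using parallelogram[of f g] by (simp add: B_def field_simps)

text \<open>Additivity in \<open>a\<close> comes from \<open>B_add\<close>. Boundedness on the unit
  interval comes from the parallelogram law, since the difference of two nonnegative numbers is at
  most their sum.\<close>

lemma B_cmult: "B (\<lambda>x. a * f x) g = a * B f g" if "f \<in> C" "g \<in> C"
proof -
  have "B (\<lambda>x. a * f x) g = a * B (\<lambda>x. 1 * f x) g"
  proof (rule additive_bounded_imp_linear[of "\<lambda>a. B (\<lambda>x. a * f x) g"])
    fix s t :: real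
    have "(\<lambda>x. (s + t) * f x) = (\<lambda>x. s * f x) + (\<lambda>x. t * f x)"
      by (simp add: plus_fun_def distrib_right)
    then show "B (\<lambda>x. (s + t) * f x) g = B (\<lambda>x. s * f x) g + B (\<lambda>x. t * f x) g"
      using that by (simp add: B_add C_cmult)
  next
    fix t :: real assume t: "0 \<le> t" "t \<le> 1"
    let ?f = "\<lambda>x. t * f x"
    have "?f \<in> C" using that(1) by (rule C_cmult)
    then have "0 \<le> Q (?f + g)" "0 \<le> Q (?f - g)" "Q (?f + g) + Q (?f - g) = 2 * Q ?f + 2 * Q g"
      using that by (auto intro: Q_nonneg C_add C_diff parallelogram)
    moreover have "Q ?f \<le> Q f"
      using t Q_nonneg[OF that(1)] that(1) by (simp add: Q_cmult mult_left_le_one_le power_le_one)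
    ultimately show "\<bar>B ?f g\<bar> \<le> Q f + Q g"
      by (simp add: B_def)
  qed
  then show ?thesis by simp
qed

text \<open>Evaluation at a point is continuous: test with \<open>[(c, x)]\<close> and maximise over
  \<open>c\<close>. This yields definiteness of \<open>B\<close> and pointwise convergence of Cauchy
  sequences.\<close>

lemma point_bound:
  assumes "f \<in> C" shows "(f x)\<^sup>2 \<le> k x x * Q f"
proof -
  have le: "2 * c * f x - c\<^sup>2 * k x x \<le> Q f" for c
    using gap_le_Q[OF assms, of "[(c, x)]"] by (simp add: gap_def qform_def power2_eq_square)
  show ?thesis
  proof (cases "k x x = 0")
    case True
    have "f x = 0"
    proof (rule ccontr)
      assume "f x \<noteq> 0"
      then show False using le[of "(Q f + 1) / (2 * f x)"] True by simp
    qed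
    with True show ?thesis by simp
  next
    case False
    then have "k x x > 0" using pd_kernel_diag_nonneg[OF pd, of x] by simp
    then show ?thesis using le[of "f x / k x x"] by (simp add: field_simps power2_eq_square)
  qed
qed

section \<open>Hilbert space structure and completeness\<close>

definition H :: "('a \<Rightarrow> real) inner_space" where
  "H = \<lparr>carrier = C, monoid.mult = (\<lambda>f g. f), one = 0, zero = 0, add = (+),
        smult = (\<lambda>a f x. a * f x), ip = B\<rparr>"

lemma H_simps:
  "carrier H = C" "\<zero>\<^bsub>H\<^esub> = 0" "f \<oplus>\<^bsub>H\<^esub> g = f + g" "a \<odot>\<^bsub>H\<^esub> f = (\<lambda>x. a * f x)" "ip H f g = B f g"
  by (simp_all add: H_def)

lemma real_inner_space_H: "real_inner_space H"
proof (intro real_inner_space.intro real_inner_space_axioms.intro)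
  have "abelian_group H"
  proof (rule abelian_groupI)
    fix f assume "f \<in> carrier H"
    then show "\<exists>g\<in>carrier H. g \<oplus>\<^bsub>H\<^esub> f = \<zero>\<^bsub>H\<^esub>"
      by (auto simp: H_simps C_minus intro!: bexI[of _ "- f"])
  qed (auto simp: H_simps C_add C_zero add.assoc add.commute)
  then show "Module.module real_ring H"
    by (rule Module.moduleI[OF cring_real_ring])
      (auto simp: H_simps C_cmult plus_fun_def distrib_left distrib_right mult.assoc)
next
  fix f assume f: "f \<in> carrier H" "ip H f f = 0"
  then have "f x = 0" for x
    using point_bound[of f x] by (simp add: H_simps B_self)
  then show "f = \<zero>\<^bsub>H\<^esub>"
    by (auto simp: H_simps)
qed (auto simp: H_simps B_add B_cmult B_self Q_nonneg intro: B_commute)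

sublocale real_inner_space H
  by (rule real_inner_space_H)

sublocale M: Metric_space "carrier H" "hdist H"
  by (rule Metric_space_hdist)

lemma hdist_H: "\<lbrakk>f \<in> C; g \<in> C\<rbrakk> \<Longrightarrow> hdist H f g = sqrt (Q (f - g))"
  by (simp add: hdist_sq H_simps B_self Q_diff)

text \<open>A Cauchy sequence has a pointwise limit \<open>l\<close>. For fixed \<open>e\<close>,
  \<open>gap\<close> is continuous under pointwise limits, so bounds on
  \<open>Q (\<sigma> n - \<sigma> m)\<close> survive \<open>m \<rightarrow> \<infinity>\<close> and
  bound \<open>Q (\<sigma> n - l)\<close>.\<close>

lemma complete_H: "M.mcomplete"
  unfolding M.mcomplete_def
proof (intro allI impI)
  fix \<sigma> assume \<sigma>: "M.MCauchy \<sigma>"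
  then have C: "\<sigma> n \<in> C" for n
    unfolding M.MCauchy_def by (auto simp: H_simps)
  have Cauchy: "\<exists>N. \<forall>n\<ge>N. \<forall>m\<ge>N. Q (\<sigma> n - \<sigma> m) \<le> \<epsilon>\<^sup>2" if "\<epsilon> > 0" for \<epsilon>
  proof -
    have "\<exists>N. \<forall>n m. N \<le> n \<longrightarrow> N \<le> m \<longrightarrow> hdist H (\<sigma> n) (\<sigma> m) < \<epsilon>"
      using \<sigma> that unfolding M.MCauchy_def by simp
    then obtain N where N: "\<And>n m. N \<le> n \<Longrightarrow> N \<le> m \<Longrightarrow> hdist H (\<sigma> n) (\<sigma> m) < \<epsilon>"
      by blast
    have "Q (\<sigma> n - \<sigma> m) \<le> \<epsilon>\<^sup>2" if "N \<le> n" "N \<le> m" for n m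
      using less_imp_le[OF N[OF that]] unfolding hdist_H[OF C C] by (rule sqrt_le_D)
    then show ?thesis by blast
  qed
  have "convergent (\<lambda>n. \<sigma> n x)" for x
  proof (rule Cauchy_convergent, rule metric_CauchyI)
    fix \<epsilon> :: real assume "\<epsilon> > 0"
    \<comment> \<open>Chosen so that \<open>k x x * \<delta>\<^sup>2 < \<epsilon>\<^sup>2\<close>;
      the 1 covers \<open>k x x = 0\<close>.\<close>
    define \<delta> where "\<delta> = \<epsilon> / (k x x + 1)"
    have kx: "k x x \<ge> 0" by (rule pd_kernel_diag_nonneg[OF pd])
    with \<open>\<epsilon> > 0\<close> have "\<delta> > 0" by (simp add: \<delta>_def)
    then obtain N where N: "\<forall>n\<ge>N. \<forall>m\<ge>N. Q (\<sigma> n - \<sigma> m) \<le> \<delta>\<^sup>2"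
      using Cauchy by blast
    have "dist (\<sigma> m x) (\<sigma> n x) < \<epsilon>" if "N \<le> m" "N \<le> n" for m n
    proof -
      have "(\<sigma> m x - \<sigma> n x)\<^sup>2 \<le> k x x * Q (\<sigma> m - \<sigma> n)"
        using point_bound[OF C_diff[OF C C], of m n x] by simp
      also have "\<dots> \<le> k x x * \<delta>\<^sup>2"
        using N that kx by (intro mult_left_mono) auto
      also have "\<dots> < (k x x + 1)\<^sup>2 * \<delta>\<^sup>2"
        using kx \<open>\<delta> > 0\<close> by (intro mult_strict_right_mono)
          (auto simp: power2_eq_square algebra_simps intro!: add_pos_nonneg)
      also have "\<dots> = \<epsilon>\<^sup>2"
        using kx by (simp add: \<delta>_def power_divide)
      finally have "\<bar>\<sigma> m x - \<sigma> n x\<bar> < \<bar>\<epsilon>\<bar>"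
        by (simp add: abs_le_square_iff flip: not_le)
      with \<open>\<epsilon> > 0\<close> show ?thesis by (simp add: dist_real_def)
    qed
    then show "\<exists>N. \<forall>m\<ge>N. \<forall>n\<ge>N. dist (\<sigma> m x) (\<sigma> n x) < \<epsilon>" by blast
  qed
  then obtain l where l: "\<And>x. (\<lambda>n. \<sigma> n x) \<longlonglongrightarrow> l x"
    unfolding convergent_def by metis
  have gap: "gap (\<sigma> n - l) e \<le> \<epsilon>\<^sup>2" if "\<forall>m\<ge>N. Q (\<sigma> n - \<sigma> m) \<le> \<epsilon>\<^sup>2" for n N \<epsilon> e
  proof (rule tendsto_upperbound)
    show "(\<lambda>m. gap (\<sigma> n - \<sigma> m) e) \<longlonglongrightarrow> gap (\<sigma> n - l) e"
      unfolding gap_def fun_diff_def by (intro tendsto_intros tendsto_ev l)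
    show "\<forall>\<^sub>F m in sequentially. gap (\<sigma> n - \<sigma> m) e \<le> \<epsilon>\<^sup>2"
      using that gap_le_Q[OF C_diff[OF C C]] order_trans
      unfolding eventually_sequentially by blast
  qed simp
  obtain N where "\<forall>n\<ge>N. \<forall>m\<ge>N. Q (\<sigma> n - \<sigma> m) \<le> 1\<^sup>2"
    using Cauchy[of 1] by auto
  then have "\<sigma> N - l \<in> C"
    using gap[of N N 1] by (intro C_I[of _ "1\<^sup>2"]) auto
  from C_diff[OF C this, of N] have lC: "l \<in> C"
    by simp
  have "\<exists>N. \<forall>n\<ge>N. hdist H (\<sigma> n) l < \<epsilon>" if "\<epsilon> > 0" for \<epsilon>
  proof -
    obtain N where N: "\<forall>n\<ge>N. \<forall>m\<ge>N. Q (\<sigma> n - \<sigma> m) \<le> (\<epsilon> / 2)\<^sup>2"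
      using Cauchy[of "\<epsilon> / 2"] \<open>\<epsilon> > 0\<close> by auto
    have "hdist H (\<sigma> n) l < \<epsilon>" if "n \<ge> N" for n
    proof -
      have "Q (\<sigma> n - l) \<le> (\<epsilon> / 2)\<^sup>2"
        using N that by (intro Q_le gap[of N]) blast
      then have "sqrt (Q (\<sigma> n - l)) \<le> \<epsilon> / 2"
        using \<open>\<epsilon> > 0\<close> by (intro real_le_lsqrt) simp_all
      with \<open>\<epsilon> > 0\<close> show ?thesis using C lC by (simp add: hdist_H)
    qed
    then show ?thesis by blast
  qed
  then have "limitin M.mtopology \<sigma> l sequentially"
    using C lC unfolding M.limitin_metric by (simp add: H_simps eventually_sequentially)
  then show "\<exists>l. limitin M.mtopology \<sigma> l sequentially" by blast
qed

lemma real_hilbert_space_H: "real_hilbert_space H"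
  by (intro real_hilbert_space.intro real_hilbert_space_axioms.intro real_inner_space_H complete_H)

text \<open>Completing the square, with the distance of \<open>e\<close> and \<open>d\<close> as the
  square: the supremum of \<open>gap\<close> is attained at \<open>e = d\<close>.\<close>

lemma gap_section: "gap (\<lambda>x. ev (k x) d) e = qform k d - qform k (e @ scale_comb (-1) d)"
  using ev_cmult[of "-1" "\<lambda>x. ev (k x) d" e]
  by (simp add: gap_def qform_append[OF pd_kernel_sym[OF pd]])

lemma section_in_C: "(\<lambda>x. ev (k x) d) \<in> C"
  using qform_nonneg[OF pd] by (intro C_I[of _ "qform k d"]) (simp add: gap_section)

lemma Q_section: "Q (\<lambda>x. ev (k x) d) = qform k d"
proof (rule antisym)
  show "Q (\<lambda>x. ev (k x) d) \<le> qform k d"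
    using qform_nonneg[OF pd] by (intro Q_le) (simp add: gap_section)
  have "gap (\<lambda>x. ev (k x) d) d = qform k d"
    by (simp add: gap_def qform_def)
  then show "qform k d \<le> Q (\<lambda>x. ev (k x) d)"
    using gap_le_Q[OF section_in_C] by metis
qed

definition feature :: "'a \<Rightarrow> 'a \<Rightarrow> real" where
  "feature y = (\<lambda>x. k x y)"

lemma feature_in_C: "feature y \<in> C"
  using section_in_C[of "[(1, y)]"] by (simp add: feature_def)

lemma hdist_feature: "hdist H (feature x) (feature y) = sqrt (k x x + k y y - 2 * k x y)"
proof -
  have "feature x - feature y = (\<lambda>z. ev (k z) [(1, x), (-1, y)])"
    by (simp add: feature_def fun_diff_def)
  then have "Q (feature x - feature y) = qform k [(1, x), (-1, y)]"
    by (simp only: Q_section)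
  also have "\<dots> = k x x + k y y - 2 * k x y"
    using pd_kernel_sym[OF pd, of x y] by (simp add: qform_def)
  finally show ?thesis
    by (simp add: hdist_H feature_in_C)
qed

end

text \<open>The reproducing kernel Hilbert space consists of functions on \<open>'a\<close>, which
  is the type of points that \<open>uniformly_embeddable\<close> asks for.\<close>

lemma uniformly_embeddable_if_kernel:
  assumes "pd_kernel k" "control_function \<rho>\<^sub>l" "control_function \<rho>\<^sub>u"
    and "\<And>x y. \<lbrakk>x \<in> X; y \<in> X\<rbrakk> \<Longrightarrow> \<rho>\<^sub>l (d x y) \<le> sqrt (k x x + k y y - 2 * k x y)"
    and "\<And>x y. \<lbrakk>x \<in> X; y \<in> X\<rbrakk> \<Longrightarrow> sqrt (k x x + k y y - 2 * k x y) \<le> \<rho>\<^sub>u (d x y)"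
  shows "uniformly_embeddable X d"
proof -
  interpret kernel_space k
    using assms(1) by (rule kernel_space.intro)
  have "controlled_embedding \<rho>\<^sub>l \<rho>\<^sub>u X d H feature"
    using assms(4,5) real_hilbert_space_H
    by (simp add: controlled_embedding_def hdist_feature H_simps feature_in_C)
  with assms(2,3) show ?thesis
    unfolding uniformly_embeddable_def by blast
qed

section \<open>The kernel of a partition of unity\<close>

text \<open>The left side is \<open>min a b\<close>, in a form that can be summed over a partition
  of unity.\<close>

lemma half_sum_diff_le_sqrt_mult:
  fixes a b :: real
  assumes "0 \<le> a" "0 \<le> b"
  shows "(a + b - \<bar>a - b\<bar>) / 2 \<le> sqrt a * sqrt b"
proof -
  have "min a b * min a b \<le> a * b"
    using assms by (intro mult_mono) auto
  then have "min a b \<le> sqrt (a * b)"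
    by (intro real_le_rsqrt) (simp add: power2_eq_square)
  then show ?thesis
    by (simp add: real_sqrt_mult min_def abs_if split: if_splits)
qed

lemma sqrt_mult_le_half_sum:
  fixes a b :: real
  assumes "0 \<le> a" "0 \<le> b"
  shows "sqrt a * sqrt b \<le> (a + b) / 2"
  using arith_geo_mean_sqrt[OF assms] by (simp add: real_sqrt_mult)

text \<open>The geometric mean of the weights at \<open>x\<close> and \<open>y\<close> lies between
  their minimum and their arithmetic mean. The means sum to 1, so a common upper bound on the
  Gaussians bounds \<open>K\<close>; the minima sum to at least \<open>1 - \<epsilon> / 2\<close> if
  \<open>d x y \<le> R\<close>.\<close>

lemma kernel_of_partition_of_unity:
  fixes X :: "'a set" and I :: "'i set" and \<phi> :: "'i \<Rightarrow> 'a \<Rightarrow> real"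
  assumes d: "\<And>x y. 0 \<le> d x y"
    and \<epsilon>: "0 < \<epsilon>" "\<epsilon> \<le> 1"
    and pu: "partition_of_unity X I \<phi>"
    and var: "\<forall>x\<in>X. \<forall>y\<in>X. d x y \<le> R \<longrightarrow> (\<Sum>\<^sub>\<infinity>i\<in>I. \<bar>\<phi> i x - \<phi> i y\<bar>) \<le> \<epsilon>"
    and cover: "cover_of X I U" and sub: "subordinated_to X I \<phi> U"
    and equi: "equi_uniformly_embeddable I U (\<lambda>i. d)"
  shows "\<exists>K S. pd_kernel K \<and> (\<forall>x\<in>X. K x x = 1) \<and>
     (\<forall>x\<in>X. \<forall>y\<in>X. 0 \<le> K x y \<and> K x y \<le> 1 \<and> (d x y \<le> R \<longrightarrow> 1 - \<epsilon> \<le> K x y) \<and>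
        (S \<le> d x y \<longrightarrow> K x y \<le> 1 / 2))"
proof -
  obtain H :: "'i \<Rightarrow> ('a \<Rightarrow> real) inner_space" and F \<rho>\<^sub>l \<rho>\<^sub>u where
    \<rho>: "control_function \<rho>\<^sub>l" "control_function \<rho>\<^sub>u" and
    emb: "\<And>i. i \<in> I \<Longrightarrow> controlled_embedding \<rho>\<^sub>l \<rho>\<^sub>u (U i) d (H i) (F i)"
    using equi unfolding equi_uniformly_embeddable_def by blast
  \<comment> \<open>Makes the Gaussian exponent at most \<open>\<epsilon> / 2\<close> in size within
    distance \<open>R\<close>; the added 1 covers \<open>\<rho>\<^sub>u R = 0\<close>.\<close>
  define t where "t = \<epsilon> / (2 * ((\<rho>\<^sub>u R)\<^sup>2 + 1))"
  have "(\<rho>\<^sub>u R)\<^sup>2 + 1 > 0"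
    by (simp add: add_nonneg_pos)
  then have t: "t > 0" and t_le: "t * (\<rho>\<^sub>u R)\<^sup>2 \<le> \<epsilon> / 2"
    using \<epsilon> by (simp_all add: t_def field_simps)
  define E where "E i x y =
    (if x \<in> U i \<and> y \<in> U i then exp (- t * (hdist (H i) (F i x) (F i y))\<^sup>2) else 0)" for i x y
  \<comment> \<open>The value 0 off \<open>U i\<close> agrees with \<open>sqrt (\<phi> i x)\<close>
    on \<open>X\<close> and makes \<open>k i\<close> vanish outside \<open>X\<close>, so that the
    sum over \<open>i\<close> exists for all points of the type.\<close>
  define g where "g i x = (if x \<in> U i then sqrt (\<phi> i x) else 0)" for i x
  define k where "k i x y = g i x * g i y * E i x y" for i x y
  define K where "K x y = (\<Sum>\<^sub>\<infinity>i\<in>I. k i x y)" for x y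
  have U: "U i \<subseteq> X" if "i \<in> I" for i
    using cover that by (auto simp: cover_of_def)
  have \<phi>_nonneg: "0 \<le> \<phi> i x" if "i \<in> I" "x \<in> X" for i x
    using pu that unfolding partition_of_unity_def by fastforce
  have \<phi>_sum: "((\<lambda>i. \<phi> i x) has_sum 1) I" if "x \<in> X" for x
    using pu that by (simp add: partition_of_unity_def)
  have g: "g i x = sqrt (\<phi> i x)" if "i \<in> I" "x \<in> X" for i x
    using sub that by (auto simp: g_def subordinated_to_def)
  have E: "0 \<le> E i x y" "E i x y \<le> 1" for i x y
    using t by (auto simp: E_def)
  have pd_k: "pd_kernel (k i)" if "i \<in> I" for i
  proof -
    interpret real_inner_space "H i"
      using emb[OF that] unfolding controlled_embedding_def real_hilbert_space_def by blast
    have "pd_kernel (E i)"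
      using pd_kernel_gaussian[of "F i" "U i" t] emb[OF that] t
      by (simp add: controlled_embedding_def E_def[abs_def])
    from pd_kernel_pullback[OF this, of "g i" "\<lambda>x. x"] show ?thesis
      by (simp add: k_def[abs_def])
  qed
  have k_nonneg: "0 \<le> k i x y" if "i \<in> I" "x \<in> X" "y \<in> X" for i x y
    using that E(1) by (simp add: k_def g \<phi>_nonneg)
  have k_le: "k i x y \<le> c * ((\<phi> i x + \<phi> i y) / 2)" if "i \<in> I" "x \<in> X" "y \<in> X" "E i x y \<le> c" for i x y c
  proof -
    have "k i x y \<le> ((\<phi> i x + \<phi> i y) / 2) * c"
      unfolding k_def using that E(1)[of i x y] sqrt_mult_le_half_sum[of "\<phi> i x" "\<phi> i y"]
      by (intro mult_mono) (auto simp: g \<phi>_nonneg)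
    then show ?thesis by (simp add: mult.commute)
  qed
  have mean: "((\<lambda>i. c * ((\<phi> i x + \<phi> i y) / 2)) has_sum c) I" if "x \<in> X" "y \<in> X" for x y c
    using has_sum_cmult_right[OF has_sum_add[OF \<phi>_sum \<phi>_sum], OF that, of "c / 2"] by simp
  have k_summable: "(\<lambda>i. k i x y) summable_on I" for x y
  proof (cases "x \<in> X \<and> y \<in> X")
    case True
    then show ?thesis
      using mean[of x y 1] k_le[where c = 1] E(2) k_nonneg
      by (intro summable_on_comparison_test[OF has_sum_imp_summable[OF mean[of x y 1]]]) auto
  next
    case False
    then have "k i x y = 0" if "i \<in> I" for i
      using U[OF that] by (auto simp: k_def g_def)
    then show ?thesis
      by (rule summable_on_0)
  qed
  then have K: "((\<lambda>i. k i x y) has_sum K x y) I" for x y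
    by (simp add: K_def)
  have pd_K: "pd_kernel K"
    using pd_k K by (rule pd_kernel_has_sum)
  have K_le: "K x y \<le> c" if "x \<in> X" "y \<in> X" "\<And>i. i \<in> I \<Longrightarrow> E i x y \<le> c" for x y c
    using that by (intro has_sum_mono[OF K mean[of x y c]] k_le) auto
  have K_nonneg: "0 \<le> K x y" if "x \<in> X" "y \<in> X" for x y
    by (rule has_sum_nonneg[OF K]) (rule k_nonneg[OF _ that])
  have K_self: "K x x = 1" if "x \<in> X" for x
  proof -
    have "k i x x = \<phi> i x" if "i \<in> I" for i
    proof (cases "x \<in> U i")
      case True
      interpret real_inner_space "H i"
        using emb[OF that] unfolding controlled_embedding_def real_hilbert_space_def by blast
      have "F i x \<in> carrier (H i)"
        using emb[OF that] True by (auto simp: controlled_embedding_def)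
      then have "hdist (H i) (F i x) (F i x) = 0"
        by (simp add: hdist_eq_zero)
      with True show ?thesis
        using \<phi>_nonneg that \<open>x \<in> X\<close> by (simp add: k_def E_def g)
    next
      case False
      then show ?thesis
        using sub that \<open>x \<in> X\<close> by (simp add: k_def g_def subordinated_to_def)
    qed
    then have "((\<lambda>i. k i x x) has_sum 1) I"
      using has_sum_cong[of I "\<lambda>i. k i x x" "\<lambda>i. \<phi> i x"] \<phi>_sum[OF that] by simp
    with K show ?thesis by (rule has_sum_unique)
  qed
  have near: "1 - \<epsilon> \<le> K x y" if xy: "x \<in> X" "y \<in> X" "d x y \<le> R" for x y
  proof -
    define c where "c = exp (- t * (\<rho>\<^sub>u R)\<^sup>2)"
    let ?v = "\<Sum>\<^sub>\<infinity>i\<in>I. \<bar>\<phi> i x - \<phi> i y\<bar>"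
    have "(\<lambda>i. \<phi> i x - \<phi> i y) summable_on I"
      using has_sum_add[OF \<phi>_sum[OF xy(1)] has_sum_cmult_right[OF \<phi>_sum[OF xy(2)], of "-1"]]
      by (auto dest: has_sum_imp_summable)
    then have "((\<lambda>i. \<bar>\<phi> i x - \<phi> i y\<bar>) has_sum ?v) I"
      using summable_on_iff_abs_summable_on_real[of "\<lambda>i. \<phi> i x - \<phi> i y"] by simp
    \<comment> \<open>The minorant is \<open>c\<close> times the minimum of the two weights, where
      \<open>c\<close> bounds from below each Gaussian whose \<open>U i\<close> contains both
      points; for the other \<open>i\<close> the minorant is 0.\<close>
    then have "((\<lambda>i. c / 2 * (\<phi> i x + \<phi> i y + - \<bar>\<phi> i x - \<phi> i y\<bar>)) has_sum c / 2 * (1 + 1 + - ?v)) I"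
      using \<phi>_sum xy by (intro has_sum_cmult_right has_sum_add) (simp_all add: has_sum_uminus)
    then have le_K: "c / 2 * (1 + 1 + - ?v) \<le> K x y"
    proof (rule has_sum_mono[OF _ K])
      fix i assume i: "i \<in> I"
      show "c / 2 * (\<phi> i x + \<phi> i y + - \<bar>\<phi> i x - \<phi> i y\<bar>) \<le> k i x y"
      proof (cases "x \<in> U i \<and> y \<in> U i")
        case True
        have "hdist (H i) (F i x) (F i y) \<le> \<rho>\<^sub>u (d x y)"
          using emb[OF i] True by (simp add: controlled_embedding_def)
        also have "\<dots> \<le> \<rho>\<^sub>u R"
          using \<rho>(2) d[of x y] xy(3) order_trans[OF d xy(3)] unfolding control_function_def
          by (intro mono_onD[of "{0..}" \<rho>\<^sub>u]) simp_all
        finally have "(hdist (H i) (F i x) (F i y))\<^sup>2 \<le> (\<rho>\<^sub>u R)\<^sup>2"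
          using real_inner_space.Metric_space_hdist[of "H i"] emb[OF i]
          by (intro power_mono)
            (auto simp: controlled_embedding_def real_hilbert_space_def dest: Metric_space.nonneg)
        then have "c \<le> E i x y"
          using True t by (simp add: c_def E_def)
        moreover have "(\<phi> i x + \<phi> i y - \<bar>\<phi> i x - \<phi> i y\<bar>) / 2 \<le> g i x * g i y"
          using half_sum_diff_le_sqrt_mult[of "\<phi> i x" "\<phi> i y"] \<phi>_nonneg i xy by (simp add: g)
        ultimately have "(\<phi> i x + \<phi> i y - \<bar>\<phi> i x - \<phi> i y\<bar>) / 2 * c \<le> g i x * g i y * E i x y"
          using \<phi>_nonneg i xy by (intro mult_mono) (auto simp: c_def g)
        then show ?thesis by (simp add: k_def mult.commute)
      next
        case False
        then have "\<phi> i x = 0 \<or> \<phi> i y = 0"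
          using sub i xy by (auto simp: subordinated_to_def)
        then show ?thesis
          using k_nonneg[OF i xy(1,2)] \<phi>_nonneg[OF i] xy by auto
      qed
    qed
    have "?v \<le> \<epsilon>"
      using var xy by blast
    then have v: "c / 2 * (2 - \<epsilon>) \<le> c / 2 * (1 + 1 + - ?v)"
      by (intro mult_left_mono) (auto simp: c_def)
    \<comment> \<open>Gaussian and weights each contribute a factor of at least
      \<open>1 - \<epsilon> / 2\<close>.\<close>
    have "1 - \<epsilon> / 2 \<le> c"
      using exp_ge_add_one_self[of "- t * (\<rho>\<^sub>u R)\<^sup>2"] t_le by (simp add: c_def)
    then have "(1 - \<epsilon> / 2) * (1 - \<epsilon> / 2) \<le> c * (1 - \<epsilon> / 2)"
      using \<epsilon> by (intro mult_right_mono) auto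
    moreover have "1 - \<epsilon> \<le> (1 - \<epsilon> / 2) * (1 - \<epsilon> / 2)"
      using zero_le_square[of \<epsilon>] by (simp add: algebra_simps)
    moreover have "c * (1 - \<epsilon> / 2) = c / 2 * (2 - \<epsilon>)"
      by (simp add: algebra_simps)
    ultimately show ?thesis
      using v le_K by linarith
  qed
  \<comment> \<open>The distance at which the Gaussian has dropped to \<open>1 / 2\<close>.\<close>
  have "\<forall>\<^sub>F s in at_top. sqrt (ln 2 / t) \<le> \<rho>\<^sub>l s"
    using \<rho>(1) by (auto simp: control_function_def filterlim_at_top)
  then obtain S where S: "\<And>s. S \<le> s \<Longrightarrow> sqrt (ln 2 / t) \<le> \<rho>\<^sub>l s"
    by (auto simp: eventually_at_top_linorder)
  have far: "K x y \<le> 1 / 2" if xy: "x \<in> X" "y \<in> X" "S \<le> d x y" for x y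
  proof (rule K_le[OF xy(1,2)])
    fix i assume i: "i \<in> I"
    show "E i x y \<le> 1 / 2"
    proof (cases "x \<in> U i \<and> y \<in> U i")
      case True
      have "sqrt (ln 2 / t) \<le> hdist (H i) (F i x) (F i y)"
        using S[OF xy(3)] emb[OF i] True by (fastforce simp: controlled_embedding_def)
      then have "(sqrt (ln 2 / t))\<^sup>2 \<le> (hdist (H i) (F i x) (F i y))\<^sup>2"
        using t by (intro power_mono) auto
      then have "ln 2 \<le> t * (hdist (H i) (F i x) (F i y))\<^sup>2"
        using t by (simp add: field_simps)
      then have "E i x y \<le> exp (- ln 2)"
        using True by (simp add: E_def)
      then show ?thesis by (simp add: exp_minus)
    qed (auto simp: E_def)
  qed
  show ?thesis
    using pd_K K_self K_nonneg K_le[where c = 1] E(2) near far by blast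
qed

section \<open>Superposition of the kernels\<close>

theorem theorem3p2:
  fixes X :: "'a set" and d :: "'a \<Rightarrow> 'a \<Rightarrow> real"
  assumes "Metric_space X d"
    and "\<And>R \<epsilon> :: real. R > 0 \<Longrightarrow> \<epsilon> > 0 \<Longrightarrow>
      \<exists>(I :: 'i set) \<phi> U.
        partition_of_unity X I \<phi> \<and>
        (\<forall>x\<in>X. \<forall>y\<in>X. d x y \<le> R \<longrightarrow> (\<Sum>\<^sub>\<infinity>i\<in>I. \<bar>\<phi> i x - \<phi> i y\<bar>) \<le> \<epsilon>) \<and>
        cover_of X I U \<and> subordinated_to X I \<phi> U \<and>
        equi_uniformly_embeddable I U (\<lambda>i. d)"
  shows "uniformly_embeddable X d"
proof (cases "X = {}")
  \<comment> \<open>There is no base point; with the zero kernel the bounds hold vacuously.\<close>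
  case True
  have "control_function (\<lambda>t. t)"
    by (auto simp: control_function_def mono_on_def filterlim_ident)
  with True show ?thesis
    by (intro uniformly_embeddable_if_kernel[OF pd_kernel_zero]) auto
next
  case False
  then obtain z where z: "z \<in> X" by blast
  interpret Metric_space X d by fact
  have "\<exists>K S. pd_kernel K \<and> (\<forall>x\<in>X. K x x = 1) \<and>
     (\<forall>x\<in>X. \<forall>y\<in>X. 0 \<le> K x y \<and> K x y \<le> 1 \<and> (d x y \<le> real n + 1 \<longrightarrow> 1 - (1 / 2) ^ n \<le> K x y) \<and>
        (S \<le> d x y \<longrightarrow> K x y \<le> 1 / 2))" for n
  proof -
    have n: "real n + 1 > 0" "(1 / 2 :: real) ^ n > 0" "(1 / 2 :: real) ^ n \<le> 1"
      by (simp_all add: power_le_one)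
    obtain I :: "'i set" and \<phi> U where
      "partition_of_unity X I \<phi>"
      "\<forall>x\<in>X. \<forall>y\<in>X. d x y \<le> real n + 1 \<longrightarrow> (\<Sum>\<^sub>\<infinity>i\<in>I. \<bar>\<phi> i x - \<phi> i y\<bar>) \<le> (1 / 2) ^ n"
      "cover_of X I U" "subordinated_to X I \<phi> U" "equi_uniformly_embeddable I U (\<lambda>i. d)"
      using assms(2)[OF n(1,2)] by blast
    then show ?thesis
      by (rule kernel_of_partition_of_unity[OF nonneg n(2,3)])
  qed
  then obtain K S where pd: "\<And>n. pd_kernel (K n)" and K_self: "\<And>n x. x \<in> X \<Longrightarrow> K n x x = 1"
    and K: "\<And>n x y. \<lbrakk>x \<in> X; y \<in> X\<rbrakk> \<Longrightarrow> 0 \<le> K n x y \<and> K n x y \<le> 1 \<and>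
      (d x y \<le> real n + 1 \<longrightarrow> 1 - (1 / 2) ^ n \<le> K n x y) \<and> (S n \<le> d x y \<longrightarrow> K n x y \<le> 1 / 2)"
    by metis
  define D where "D x y n = 1 - K n x y" for x y n
  define N where "N x y = (\<Sum>n. D x y n)" for x y
  have D_nonneg: "0 \<le> D x y n" if "x \<in> X" "y \<in> X" for x y n
    using K[OF that] by (simp add: D_def)
  have D_self: "D x x = (\<lambda>n. 0)" if "x \<in> X" for x
    using K_self[OF that] by (simp add: D_def fun_eq_iff)
  \<comment> \<open>A summable majorant of \<open>D x y\<close> for \<open>m\<close> the ceiling of
    \<open>d x y\<close>: the first \<open>m\<close> terms are only known to be at most 1, the later
    ones are at most \<open>(1 / 2) ^ n\<close>.\<close>
  define a where "a m n = (if n < m then 1 else 0) + (1 / 2 :: real) ^ n" for m n :: nat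
  have a: "a m sums (real m + 2)" for m
    unfolding a_def using sums_If_finite_set[of "{..<m}" "\<lambda>n. 1 :: real"] geometric_sums[of "1 / 2 :: real"]
    by (intro sums_add) auto
  have D_le: "D x y n \<le> a (nat \<lceil>d x y\<rceil>) n" if "x \<in> X" "y \<in> X" for x y n
  proof (cases "n < nat \<lceil>d x y\<rceil>")
    case True
    then show ?thesis using K[OF that] by (simp add: D_def a_def add_increasing2)
  next
    case False
    then have "d x y \<le> real n + 1" by linarith
    with False show ?thesis using K[OF that, of n] by (simp add: D_def a_def)
  qed
  have summable_D: "summable (D x y)" if "x \<in> X" "y \<in> X" for x y
    using D_le[OF that] D_nonneg[OF that]
    by (intro summable_comparison_test'[OF sums_summable[OF a]]) auto
  have N_le: "N x y \<le> d x y + 3" if "x \<in> X" "y \<in> X" for x y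
  proof -
    have "N x y \<le> (\<Sum>n. a (nat \<lceil>d x y\<rceil>) n)"
      unfolding N_def by (intro suminf_le D_le[OF that] summable_D[OF that] sums_summable[OF a])
    also have "\<dots> = real (nat \<lceil>d x y\<rceil>) + 2"
      using a by (rule sums_unique[symmetric])
    also have "\<dots> \<le> d x y + 3"
      using nonneg[of x y] by linarith
    finally show ?thesis .
  qed
  \<comment> \<open>Each of these indices contributes at least \<open>1 / 2\<close> to
    \<open>N x y\<close> when \<open>d x y = t\<close>. The condition \<open>real n \<le> t\<close>
    keeps the set finite, so that \<open>card\<close> counts it.\<close>
  define L where "L t = {n. max (S n) (real n) \<le> t}" for t
  have finite_L: "finite (L t)" for t
  proof (rule finite_subset)
    show "L t \<subseteq> {..nat \<lceil>t\<rceil>}"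
      by (auto simp: L_def) linarith
  qed simp
  have N_ge: "real (card (L (d x y))) / 2 \<le> N x y" if "x \<in> X" "y \<in> X" for x y
  proof -
    have "real (card (L (d x y))) / 2 = (\<Sum>n\<in>L (d x y). 1 / 2)"
      by simp
    also have "\<dots> \<le> (\<Sum>n\<in>L (d x y). D x y n)"
      using K[OF that] by (intro sum_mono) (auto simp: L_def D_def)
    also have "\<dots> \<le> N x y"
      unfolding N_def using summable_D[OF that] finite_L D_nonneg[OF that] by (intro sum_le_suminf) auto
    finally show ?thesis .
  qed
  \<comment> \<open>Convergence of the series for \<open>N\<close> is known only on
    \<open>X\<close>; the indicator makes \<open>k\<close> vanish elsewhere.\<close>
  define b :: "'a \<Rightarrow> real" where "b x = (if x \<in> X then 1 else 0)" for x
  define k where "k x y = b x * b y * (N x z + N y z - N x y)" for x y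
  have pd_k: "pd_kernel k"
  proof (rule pd_kernel_sums)
    show "pd_kernel (\<lambda>x y. b x * b y * (1 - K n x z - K n y z + K n x y))" for n
      by (rule pd_kernel_pullback[where h = "\<lambda>x. x"]) (rule pd_kernel_centered[OF pd K_self[OF z]])
    show "(\<lambda>n. b x * b y * (1 - K n x z - K n y z + K n x y)) sums k x y" for x y
    proof (cases "x \<in> X \<and> y \<in> X")
      case True
      \<comment> \<open>The summand is the centered kernel of \<open>K n\<close> rewritten in terms
        of \<open>D\<close>.\<close>
      then have "(\<lambda>n. D x z n + D y z n - D x y n) sums (N x z + N y z - N x y)"
        unfolding N_def using z by (intro sums_add sums_diff summable_sums summable_D) auto
      with True show ?thesis
        by (simp add: k_def b_def D_def algebra_simps)
    qed (auto simp: k_def b_def)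
  qed
  have kN: "k x x + k y y - 2 * k x y = 2 * N x y" if "x \<in> X" "y \<in> X" for x y
    using that D_self by (simp add: k_def b_def N_def)
  have \<rho>\<^sub>l: "control_function (\<lambda>t. sqrt (real (card (L t))))"
    unfolding control_function_def
  proof (intro conjI)
    show "mono_on {0..} (\<lambda>t. sqrt (real (card (L t))))"
      by (intro mono_onI real_sqrt_le_mono of_nat_mono card_mono finite_L) (auto simp: L_def)
    have "\<exists>t0. \<forall>t\<ge>t0. m \<le> card (L t)" for m
    proof (intro exI allI impI)
      \<comment> \<open>This sum dominates \<open>S n\<close> and \<open>n\<close> for all
        \<open>n < m\<close> at once, with no monotonicity of \<open>S\<close>.\<close>
      fix t assume t: "t \<ge> (\<Sum>n<m. \<bar>S n\<bar> + real n)"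
      have "{..<m} \<subseteq> L t"
      proof
        fix n assume "n \<in> {..<m}"
        then have "\<bar>S n\<bar> + real n \<le> (\<Sum>n<m. \<bar>S n\<bar> + real n)"
          by (intro member_le_sum) auto
        with t show "n \<in> L t" by (auto simp: L_def)
      qed
      then show "m \<le> card (L t)"
        using card_mono[OF finite_L, of "{..<m}" t] by simp
    qed
    then have "filterlim (\<lambda>t. card (L t)) at_top at_top"
      by (simp add: filterlim_at_top eventually_at_top_linorder)
    then show "filterlim (\<lambda>t. sqrt (real (card (L t)))) at_top at_top"
      by (intro filterlim_compose[OF sqrt_at_top] filterlim_compose[OF filterlim_real_sequentially])
  qed auto
  have \<rho>\<^sub>u: "control_function (\<lambda>t. sqrt (2 * (t + 3)))"
    unfolding control_function_def
  proof (intro conjI)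
    show "filterlim (\<lambda>t :: real. sqrt (2 * (t + 3))) at_top at_top"
      using sqrt_at_top
      by (rule filterlim_at_top_mono) (auto intro: eventually_mono[OF eventually_ge_at_top[of 0]])
  qed (auto intro!: mono_onI)
  show ?thesis
  proof (rule uniformly_embeddable_if_kernel[OF pd_k \<rho>\<^sub>l \<rho>\<^sub>u])
    fix x y assume xy: "x \<in> X" "y \<in> X"
    show "sqrt (real (card (L (d x y)))) \<le> sqrt (k x x + k y y - 2 * k x y)"
      using N_ge[OF xy] kN[OF xy] by simp
    show "sqrt (k x x + k y y - 2 * k x y) \<le> sqrt (2 * (d x y + 3))"
      using N_le[OF xy] kN[OF xy] by simp
  qed
qed

end
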